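(* Let $x\in X$ and let $\{e_i: i\in I\}\subset\mathcal A$ be an orthonormal system with respect to $\Gamma(\cdot)(x)$ which is regular. Put $n(x)=\dim(\mathcal A,\Gamma)(x)$. (i) For all $f\in\mathcal A$, $$\Gamma_2(f)(x)=R(f)(x)+\|H_f\|_{HS}^2(x).$$ (ii) Suppose $n(x)<\infty$. For all $N\in[1,\infty]$ with $N\ge n(x)$ and all $f\in\mathcal A$, $$\Gamma_2(f)(x)=R_N(f)(x)+\|H_f\|_{HS}^2(x)+\frac1{N-n(x)}\big(\mathrm{tr}\,H_f-Lf\big)^2(x)$$ $$=R_N(f)(x)+\frac1N(Lf)^2(x)+\Big\|H_f-\frac1N\,Lf\cdot\Gamma\Big\|_{HS}^2(x)+\frac1{N-n(x)}\Big(\mathrm{tr}\,H_f-\frac{n(x)}N\,Lf\Big)^2(x).$$ In the case $N=n(x)$ the last term on each right-hand side is understood as the limit $N\searrow n(x)$ (which is either $0$ or $+\infty$). (iii) For $N\in[1,\infty]$ (the case $N=n(x)=\infty$ being excluded) and $f\in\mathcal A$: $R_N(f)(x)>-\infty$ if and only if either $N>n(x)$, or $N=n(x)$ and $\mathrm{tr}\,H_f(x)=Lf(x)$.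
   Context: Let $X$ be a set, $\mathcal A$ an algebra of real-valued functions on $X$ and $L:\mathcal A\to\mathcal A$ a linear operator. Put $\Gamma(f,g)=\frac12[L(fg)-fLg-gLf]$ and $\Gamma(f)=\Gamma(f,f)$. $L$ is assumed to be a diffusion operator: $\Gamma(f)\ge0$ for all $f\in\mathcal A$, and for all $r$, all $f_1,\dots,f_r\in\mathcal A$ and every $C^\infty$ function $\psi:\mathbb R^r\to\mathbb R$ with $\psi(0)=0$ one has $\psi(f_1,\dots,f_r)\in\mathcal A$ and $L\psi(f_1,\dots,f_r)=\sum_i\psi_i(f_1,\dots,f_r)\,Lf_i+\sum_{i,j}\psi_{ij}(f_1,\dots,f_r)\,\Gamma(f_i,f_j)$, where $\psi_i,\psi_{ij}$ are partial derivatives. $L,\Gamma$ are extended to the algebra generated by $\mathcal A$ and the constants by $L1=0$, $\Gamma(1,f)=0$. Define $\Gamma_2(f,g)=\frac12[L\Gamma(f,g)-\Gamma(f,Lg)-\Gamma(g,Lf)]$, $\Gamma_2(f)=\Gamma_2(f,f)$, the Hessian $H_f(g,h)=\frac12[\Gamma(g,\Gamma(f,h))+\Gamma(h,\Gamma(f,g))-\Gamma(f,\Gamma(g,h))]$, and for $N\in[1,\infty]$ (with $1/\infty=0$) the $N$-Ricci tensor $R_N(f)(x)=\inf\{\Gamma_2(\tilde f)(x)-\frac1N(L\tilde f)^2(x):\tilde f\in\mathcal A,\ \Gamma(\tilde f-f)(x)=0\}\in[-\infty,\infty)$; $R=R_\infty$ is the Ricci tensor. For $x\in X$, $\mathcal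 A^1_x$ is the quotient of $\mathcal A$ by $\{g:\Gamma(g)(x)=0\}$, an inner product space with inner product $\Gamma(\cdot,\cdot)(x)$, and $\dim(\mathcal A,\Gamma)(x)\in\{0,1,\dots,\infty\}$ is its dimension. For a bilinear form $B$, evaluated on representatives, $\|B\|_{HS}(x)=\sup\{(\sum_{i,j=1}^rB(e_i,e_j)^2)^{1/2}: r\in\mathbb N,\ e_1,\dots,e_r\in\mathcal A,\ \Gamma(e_i,e_j)(x)=\delta_{ij}\}\in[0,\infty]$ (and $=0$ if $\dim(\mathcal A,\Gamma)(x)=0$). If $n=\dim(\mathcal A,\Gamma)(x)<\infty$, $\mathrm{tr}\,B=\sum_{i=1}^nB(e_i,e_i)$ for $e_1,\dots,e_n\in\mathcal A$ with $\Gamma(e_i,e_j)(x)=\delta_{ij}$. Here $H_f$ and $\Gamma$ in norms and traces are the bilinear forms $H_f(\cdot,\cdot)(x)$, $\Gamma(\cdot,\cdot)(x)$. Identities of the form $\Gamma_2=R_N+(\dots)$ in which $(\dots)$ is a sum of nonnegative terms, possibly $+\infty$, are understood as $R_N=\Gamma_2-(\dots)$ in $[-\infty,\infty)$. Regular orthonormal system: $I$ is $\mathbb N$ or $\{1,\dots,n\}$ for some $n\in\mathbb N$, $\{e_i:i\in I\}\subset\mathcal A$ satisfies $\Gamma(e_i,e_j)(x)=\delta_{ij}$ for all $i,j\in I$. It is regular if for all $f,g\in\mathcal A$ with $\Gamma(g)(x)=0$ there is a sequence of smooth $\psi^r:\mathbb R^r\to\mathbb R$ with $\frac{\partial}{\partial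 y_i}\psi^r(e_1(x),\dots,e_r(x))=0$ for all $i$ such that, with $g_r=\psi^r\circ(e_1,\dots,e_r)$, $\Gamma_2(f+g_r)(x)\to\Gamma_2(f+g)(x)$ as $r\to\infty$ and, if $\dim(\mathcal A,\Gamma)(x)<\infty$, in addition $Lg_r(x)\to Lg(x)$ as $r\to\infty$. (If $I=\{1,\dots,n\}$ and $r>n$, $\psi^r$ is a function of the first $n$ coordinates only.) *)

theory Defs
  imports "HOL-Analysis.Analysis" "HOL-Library.Function_Algebras"
begin

text \<open>
  A function of the real variables \<open>y\<^sub>i\<close>, \<open>i \<in> J\<close> (with \<open>J\<close> finite), is encoded as a function on
  \<open>nat \<Rightarrow> real\<close> that depends on the coordinates in \<open>J\<close> only; a function on \<open>\<real>\<^sup>r\<close> is the case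
  \<open>J = {..<r}\<close>, so coordinates are numbered from 0. For such functions, continuity
  with respect to the product topology on \<open>nat \<Rightarrow> real\<close> is continuity in the variables \<open>y\<^sub>i\<close>,
  \<open>i \<in> J\<close>. Smooth means that all iterated partial derivatives exist and are continuous.
\<close>

definition partial_der :: "nat \<Rightarrow> ((nat \<Rightarrow> real) \<Rightarrow> real) \<Rightarrow> (nat \<Rightarrow> real) \<Rightarrow> real" where
  "partial_der i \<psi> y = deriv (\<lambda>t. \<psi> (y(i := t))) (y i)"

definition smooth_in :: "nat set \<Rightarrow> ((nat \<Rightarrow> real) \<Rightarrow> real) \<Rightarrow> bool" where
  "smooth_in J \<psi> \<longleftrightarrow>
     (\<forall>y z. (\<forall>i\<in>J. y i = z i) \<longrightarrow> \<psi> y = \<psi> z) \<and>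
     (\<forall>is. set is \<subseteq> J \<longrightarrow>
        continuous_on UNIV (foldr partial_der is \<psi>) \<and>
        (\<forall>i\<in>J. \<forall>y. (\<lambda>t. foldr partial_der is \<psi> (y(i := t))) field_differentiable at (y i)))"

definition Gam :: "(('a \<Rightarrow> real) \<Rightarrow> 'a \<Rightarrow> real) \<Rightarrow> ('a \<Rightarrow> real) \<Rightarrow> ('a \<Rightarrow> real) \<Rightarrow> 'a \<Rightarrow> real" where
  "Gam L f g x = (L (f * g) x - f x * L g x - g x * L f x) / 2"

locale diffusion_operator =
  fixes A :: "('a \<Rightarrow> real) set" and L :: "('a \<Rightarrow> real) \<Rightarrow> 'a \<Rightarrow> real"
  assumes zero_mem: "0 \<in> A"
    and add_mem: "\<lbrakk>f \<in> A; g \<in> A\<rbrakk> \<Longrightarrow> f + g \<in> A"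
    and scale_mem: "f \<in> A \<Longrightarrow> (\<lambda>y. c * f y) \<in> A"
    and mult_mem: "\<lbrakk>f \<in> A; g \<in> A\<rbrakk> \<Longrightarrow> f * g \<in> A"
    and L_mem: "f \<in> A \<Longrightarrow> L f \<in> A"
    and L_add: "\<lbrakk>f \<in> A; g \<in> A\<rbrakk> \<Longrightarrow> L (f + g) = L f + L g"
    and L_scale: "f \<in> A \<Longrightarrow> L (\<lambda>y. c * f y) = (\<lambda>y. c * L f y)"
    and Gam_nonneg: "f \<in> A \<Longrightarrow> 0 \<le> Gam L f f x"
    and comp_mem:
      "\<lbrakk>\<forall>i<r. F i \<in> A; smooth_in {..<r} \<psi>; \<psi> (\<lambda>_. 0) = 0\<rbrakk> \<Longrightarrow> (\<lambda>y. \<psi> (\<lambda>i. F i y)) \<in> A"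
    and chain_rule:
      "\<lbrakk>\<forall>i<r. F i \<in> A; smooth_in {..<r} \<psi>; \<psi> (\<lambda>_. 0) = 0\<rbrakk> \<Longrightarrow>
         L (\<lambda>y. \<psi> (\<lambda>i. F i y)) x =
           (\<Sum>i<r. partial_der i \<psi> (\<lambda>k. F k x) * L (F i) x) +
           (\<Sum>i<r. \<Sum>j<r. partial_der j (partial_der i \<psi>) (\<lambda>k. F k x) * Gam L (F i) (F j) x)"

text \<open>
  The extension of \<open>L\<close> to the algebra generated by \<open>A\<close> and the constants, with \<open>L 1 = 0\<close>.
  It does not depend on the choice of \<open>f\<close>: if the constants are not in \<open>A\<close>, then \<open>f\<close> is unique;
  otherwise the chain rule gives \<open>L 1 = 0\<close> already on \<open>A\<close>. The extension of \<open>\<Gamma>\<close>, with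
  \<open>\<Gamma>(1, f) = 0\<close>, is \<open>Gam (ext A L)\<close>.
\<close>

definition ext ::
  "('a \<Rightarrow> real) set \<Rightarrow> (('a \<Rightarrow> real) \<Rightarrow> 'a \<Rightarrow> real) \<Rightarrow> ('a \<Rightarrow> real) \<Rightarrow> 'a \<Rightarrow> real" where
  "ext A L h = L (SOME f. f \<in> A \<and> (\<exists>c. h = f + (\<lambda>_. c)))"

definition Gam2 :: "(('a \<Rightarrow> real) \<Rightarrow> 'a \<Rightarrow> real) \<Rightarrow> ('a \<Rightarrow> real) \<Rightarrow> ('a \<Rightarrow> real) \<Rightarrow> 'a \<Rightarrow> real" where
  "Gam2 L f g x = (L (Gam L f g) x - Gam L f (L g) x - Gam L g (L f) x) / 2"

definition Hess ::
  "(('a \<Rightarrow> real) \<Rightarrow> 'a \<Rightarrow> real) \<Rightarrow> ('a \<Rightarrow> real) \<Rightarrow> ('a \<Rightarrow> real) \<Rightarrow> ('a \<Rightarrow> real) \<Rightarrow> 'a \<Rightarrow> real" where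
  "Hess L f g h x =
     (Gam L g (Gam L f h) x + Gam L h (Gam L f g) x - Gam L f (Gam L g h) x) / 2"

text \<open>The real number \<open>1/N\<close> for \<open>N > 0\<close>, with \<open>1/\<infinity> = 0\<close>.\<close>

definition recip :: "ereal \<Rightarrow> real" where
  "recip N = real_of_ereal (1 / N)"

definition N_Ricci ::
  "('a \<Rightarrow> real) set \<Rightarrow> (('a \<Rightarrow> real) \<Rightarrow> 'a \<Rightarrow> real) \<Rightarrow> ereal \<Rightarrow> ('a \<Rightarrow> real) \<Rightarrow> 'a \<Rightarrow> ereal" where
  "N_Ricci A L N f x =
     (INF h \<in> {h \<in> A. Gam L (h - f) (h - f) x = 0}. ereal (Gam2 L h h x - recip N * (L h x)\<^sup>2))"

definition Ricci ::
  "('a \<Rightarrow> real) set \<Rightarrow> (('a \<Rightarrow> real) \<Rightarrow> 'a \<Rightarrow> real) \<Rightarrow> ('a \<Rightarrow> real) \<Rightarrow> 'a \<Rightarrow> ereal" where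
  "Ricci A L = N_Ricci A L \<infinity>"

text \<open>
  The classes of \<open>F 0, \<dots>, F (r - 1)\<close> are linearly independent in the quotient of \<open>A\<close> by
  \<open>{g. \<Gamma>(g)(x) = 0}\<close>.
\<close>

definition indep_mod ::
  "('a \<Rightarrow> real) set \<Rightarrow> (('a \<Rightarrow> real) \<Rightarrow> 'a \<Rightarrow> real) \<Rightarrow> 'a \<Rightarrow> nat \<Rightarrow> (nat \<Rightarrow> 'a \<Rightarrow> real) \<Rightarrow> bool" where
  "indep_mod A L x r F \<longleftrightarrow>
     (\<forall>i<r. F i \<in> A) \<and>
     (\<forall>c :: nat \<Rightarrow> real. let s = (\<lambda>y. \<Sum>i<r. c i * F i y) in Gam L s s x = 0 \<longrightarrow> (\<forall>i<r. c i = 0))"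

definition dim_at ::
  "('a \<Rightarrow> real) set \<Rightarrow> (('a \<Rightarrow> real) \<Rightarrow> 'a \<Rightarrow> real) \<Rightarrow> 'a \<Rightarrow> enat" where
  "dim_at A L x = (SUP r \<in> {r. \<exists>F. indep_mod A L x r F}. enat r)"

definition orthonormal_at ::
  "('a \<Rightarrow> real) set \<Rightarrow> (('a \<Rightarrow> real) \<Rightarrow> 'a \<Rightarrow> real) \<Rightarrow> 'a \<Rightarrow> nat set \<Rightarrow> (nat \<Rightarrow> 'a \<Rightarrow> real) \<Rightarrow> bool"
where
  "orthonormal_at A L x J e \<longleftrightarrow>
     (\<forall>i\<in>J. e i \<in> A) \<and> (\<forall>i\<in>J. \<forall>j\<in>J. Gam L (e i) (e j) x = (if i = j then 1 else 0))"

text \<open>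
  The supremum includes \<open>r = 0\<close>, which contributes the value 0; so the norm is 0 when the
  dimension is 0.
\<close>

definition HS_norm ::
  "('a \<Rightarrow> real) set \<Rightarrow> (('a \<Rightarrow> real) \<Rightarrow> 'a \<Rightarrow> real) \<Rightarrow> 'a \<Rightarrow>
     (('a \<Rightarrow> real) \<Rightarrow> ('a \<Rightarrow> real) \<Rightarrow> real) \<Rightarrow> ereal" where
  "HS_norm A L x B =
     (SUP (r, e) \<in> {(r, e). orthonormal_at A L x {..<r} e}.
        ereal (sqrt (\<Sum>i<r. \<Sum>j<r. (B (e i) (e j))\<^sup>2)))"

text \<open>
  Only meaningful if the dimension is finite and \<open>B\<close> descends to the quotient; the sum is then
  the same for every orthonormal basis.
\<close>

definition trace_at ::
  "('a \<Rightarrow> real) set \<Rightarrow> (('a \<Rightarrow> real) \<Rightarrow> 'a \<Rightarrow> real) \<Rightarrow> 'a \<Rightarrow>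
     (('a \<Rightarrow> real) \<Rightarrow> ('a \<Rightarrow> real) \<Rightarrow> real) \<Rightarrow> real" where
  "trace_at A L x B =
     (let n = the_enat (dim_at A L x); e = (SOME e. orthonormal_at A L x {..<n} e)
      in \<Sum>i<n. B (e i) (e i))"

text \<open>
  The index set is \<open>UNIV\<close> or \<open>{..<n}\<close>. The function \<open>\<psi> r\<close> depends on the first \<open>r\<close> variables with
  index in \<open>I\<close>, so that for \<open>I = {..<n}\<close> and \<open>r > n\<close> it is a function of \<open>n\<close> variables. It need not
  vanish at the origin, hence the extension of \<open>L\<close> on the left of the limits.
\<close>

definition regular_system ::
  "('a \<Rightarrow> real) set \<Rightarrow> (('a \<Rightarrow> real) \<Rightarrow> 'a \<Rightarrow> real) \<Rightarrow> 'a \<Rightarrow> nat set \<Rightarrow> (nat \<Rightarrow> 'a \<Rightarrow> real) \<Rightarrow> bool"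
where
  "regular_system A L x I e \<longleftrightarrow>
     (\<forall>f\<in>A. \<forall>g\<in>A. Gam L g g x = 0 \<longrightarrow>
        (\<exists>\<psi> :: nat \<Rightarrow> (nat \<Rightarrow> real) \<Rightarrow> real.
           (\<forall>r. smooth_in (I \<inter> {..<r}) (\<psi> r) \<and>
                (\<forall>i \<in> I \<inter> {..<r}. partial_der i (\<psi> r) (\<lambda>j. e j x) = 0)) \<and>
           (let G = (\<lambda>r y. \<psi> r (\<lambda>j. e j y)) in
              (\<lambda>r. Gam2 (ext A L) (f + G r) (f + G r) x) \<longlonglongrightarrow> Gam2 L (f + g) (f + g) x \<and>
              (dim_at A L x < \<infinity> \<longrightarrow> (\<lambda>r. ext A L (G r) x) \<longlonglongrightarrow> L g x))))"

definition regular_orthonormal_system ::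
  "('a \<Rightarrow> real) set \<Rightarrow> (('a \<Rightarrow> real) \<Rightarrow> 'a \<Rightarrow> real) \<Rightarrow> 'a \<Rightarrow> nat set \<Rightarrow> (nat \<Rightarrow> 'a \<Rightarrow> real) \<Rightarrow> bool"
where
  "regular_orthonormal_system A L x I e \<longleftrightarrow>
     (I = UNIV \<or> (\<exists>n. I = {..<n})) \<and> orthonormal_at A L x I e \<and> regular_system A L x I e"

text \<open>
  The term \<open>q(N)/(N - n)\<close>, read as the limit for \<open>M\<close> decreasing to \<open>n\<close> of \<open>q(M)/(M - n)\<close> if \<open>N = n\<close>.
\<close>

definition quot_term :: "nat \<Rightarrow> (ereal \<Rightarrow> real) \<Rightarrow> ereal \<Rightarrow> ereal" where
  "quot_term n q N =
     (let T = (\<lambda>M. ereal (recip (M - ereal (real n)) * q M)) in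
      if N = ereal (real n) then Lim (at_right N) T else T N)"

end

theory Submission
  imports Defs
begin

text \<open>
  Fix \<open>f\<close> and let \<open>F\<^sub>1, \<dots>, F\<^sub>r\<close> be orthonormal at \<open>x\<close>. If \<open>\<psi>\<close> is smooth with vanishing first derivatives at
  \<open>F(x)\<close> and second derivatives \<open>a\<^sub>i\<^sub>j\<close> there, then \<open>g = \<psi>(F)\<close> is null at \<open>x\<close>, and the diffusion
      property gives
  \<open>\<Gamma>\<^sub>2(f + g) = \<Gamma>\<^sub>2(f) + \<Sum>\<^sub>i\<^sub>j (2 a\<^sub>i\<^sub>j H\<^sub>f(F\<^sub>i, F\<^sub>j) + a\<^sub>i\<^sub>j\<^sup>2)\<close> and \<open>L(f + g) = L f + tr a\<close> at \<open>x\<close>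
  (\<open>second_order_perturbation\<close>). The key cancellation is that of the third derivatives of \<open>\<psi>\<close>, by
  Schwarz' theorem.

  So the infimum defining \<open>R\<^sub>N(f)(x)\<close> becomes a quadratic minimisation over symmetric matrices. Every
  matrix is attained by a quadratic \<open>\<psi>\<close>, in any orthonormal system, which bounds \<open>R\<^sub>N\<close> from above
  (\<open>N_Ricci_le\<close>); regularity says that the values of all competitors are limits of such values in the
  regular system, which bounds \<open>R\<^sub>N\<close> from below (\<open>N_Ricci_ge\<close>). For \<open>N = \<infinity>\<close> one completes the square,
  the minimum being minus the sum of the squared entries of the Hessian (\<open>Ricci_eq\<close>). For finite \<open>N\<close> one
  writes \<open>b = a + h\<close> with \<open>h\<close> the matrix of \<open>H\<^sub>f\<close>; there remains \<open>|b|\<^sup>2 - 1/N (L f - tr h + tr b)\<^sup>2\<close>,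
      which by
  \<open>(tr b)\<^sup>2 \<le> n |b|\<^sup>2\<close> is smallest at a multiple of the identity. Its minimum is
  \<open>- (L f - tr h)\<^sup>2 / (N - n)\<close> if \<open>n < N\<close>; for \<open>N = n\<close> it is \<open>0\<close> or \<open>- \<infinity>\<close>, and for \<open>N < n\<close> it is \<open>- \<infinity>\<close>.

  One point is hidden in the statement: traces and norms in finite dimension are meaningful
  because \<open>H\<^sub>f\<close> descends to the quotient of \<open>A\<close> by null functions. This is false for general
  diffusion operators and is a consequence of regularity: comparing the lower bound in the
  regular system with the upper bound in all others shows that \<open>H\<^sub>f\<close> is bounded on unit
  vectors, among which are all \<open>u + t g\<close> with \<open>g\<close> null (\<open>quotient_form_Hess\<close>).
\<close>

section \<open>Smooth functions of finitely many coordinates\<close>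

lemma partial_der_eqI:
  "((\<lambda>t. \<psi> (y(i := t))) has_field_derivative D) (at (y i)) \<Longrightarrow> partial_der i \<psi> y = D"
  unfolding partial_der_def by (rule DERIV_imp_deriv)

definition depends_on :: "nat set \<Rightarrow> ((nat \<Rightarrow> real) \<Rightarrow> real) \<Rightarrow> bool" where
  "depends_on J \<psi> \<longleftrightarrow> (\<forall>y z. (\<forall>i\<in>J. y i = z i) \<longrightarrow> \<psi> y = \<psi> z)"

definition partially_differentiable :: "nat \<Rightarrow> ((nat \<Rightarrow> real) \<Rightarrow> real) \<Rightarrow> bool" where
  "partially_differentiable i \<psi> \<longleftrightarrow> (\<forall>y. (\<lambda>t. \<psi> (y(i := t))) field_differentiable at (y i))"

text \<open>
  The derivative is taken at an arbitrary value \<open>s\<close> of the coordinate, which is the form in which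
  the mean value theorem consumes it.
\<close>
lemma partially_differentiableD:
  assumes "partially_differentiable i \<psi>"
  shows "((\<lambda>t. \<psi> (y(i := t))) has_field_derivative partial_der i \<psi> (y(i := s))) (at s)"
proof -
  have "(\<lambda>t. \<psi> ((y(i := s))(i := t))) field_differentiable at ((y(i := s)) i)"
    using assms unfolding partially_differentiable_def by blast
  then show ?thesis
    unfolding partial_der_def by (simp add: DERIV_deriv_iff_field_differentiable)
qed

lemma smooth_in_iff:
  "smooth_in J \<psi> \<longleftrightarrow> depends_on J \<psi> \<and>
     (\<forall>is. set is \<subseteq> J \<longrightarrow> continuous_on UNIV (foldr partial_der is \<psi>) \<and>
        (\<forall>i\<in>J. partially_differentiable i (foldr partial_der is \<psi>)))"
  unfolding smooth_in_def depends_on_def partially_differentiable_def by blast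

lemma smooth_inD:
  assumes "smooth_in J \<psi>"
  shows "depends_on J \<psi>" "continuous_on UNIV \<psi>" "i \<in> J \<Longrightarrow> partially_differentiable i \<psi>"
proof -
  show "depends_on J \<psi>" using assms by (simp add: smooth_in_iff)
  have "continuous_on UNIV (foldr partial_der [] \<psi>) \<and>
        (\<forall>i\<in>J. partially_differentiable i (foldr partial_der [] \<psi>))"
    using assms unfolding smooth_in_iff by (metis empty_set empty_subsetI)
  then show "continuous_on UNIV \<psi>" "i \<in> J \<Longrightarrow> partially_differentiable i \<psi>" by auto
qed

lemma depends_on_partial_der:
  assumes "depends_on J \<psi>" "i \<in> J"
  shows "depends_on J (partial_der i \<psi>)"
  unfolding depends_on_def
proof (intro allI impI)
  fix y z :: "nat \<Rightarrow> real" assume yz: "\<forall>i\<in>J. y i = z i"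
  then have "(\<lambda>t. \<psi> (y(i := t))) = (\<lambda>t. \<psi> (z(i := t)))"
    using assms(1) unfolding depends_on_def by (intro ext) auto
  then show "partial_der i \<psi> y = partial_der i \<psi> z"
    using yz assms(2) by (simp add: partial_der_def)
qed

lemma partial_der_outside:
  assumes "depends_on J \<psi>" "i \<notin> J"
  shows "partial_der i \<psi> = (\<lambda>_. 0)" "partially_differentiable i \<psi>"
proof -
  have *: "(\<lambda>t. \<psi> (y(i := t))) = (\<lambda>_. \<psi> y)" for y
    using assms unfolding depends_on_def by (intro ext) auto
  show "partial_der i \<psi> = (\<lambda>_. 0)"
    by (intro ext partial_der_eqI) (simp add: *)
  show "partially_differentiable i \<psi>"
    unfolding partially_differentiable_def * by (simp add: field_differentiable_const)
qed

lemma smooth_in_partial_der: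
  assumes "smooth_in J \<psi>" "i \<in> J"
  shows "smooth_in J (partial_der i \<psi>)"
  unfolding smooth_in_iff
proof (intro conjI allI impI)
  show "depends_on J (partial_der i \<psi>)"
    by (intro depends_on_partial_der smooth_inD(1) assms)
  fix "is" assume "set is \<subseteq> J"
  then have "set (is @ [i]) \<subseteq> J" using assms(2) by simp
  then have "continuous_on UNIV (foldr partial_der (is @ [i]) \<psi>) \<and>
        (\<forall>j\<in>J. partially_differentiable j (foldr partial_der (is @ [i]) \<psi>))"
    using assms(1) unfolding smooth_in_iff by blast
  then show "continuous_on UNIV (foldr partial_der is (partial_der i \<psi>))"
    "\<forall>j\<in>J. partially_differentiable j (foldr partial_der is (partial_der i \<psi>))" by auto
qed

text \<open>
  Smoothness quantifies over all lists of partial derivatives; it is enough to exhibit a class of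
  functions that is closed under one partial derivative at a time.
\<close>
lemma smooth_in_coinduct:
  assumes "\<psi> \<in> C"
    and dep: "\<And>\<phi>. \<phi> \<in> C \<Longrightarrow> depends_on J \<phi>"
    and cont: "\<And>\<phi>. \<phi> \<in> C \<Longrightarrow> continuous_on UNIV \<phi>"
    and pd: "\<And>\<phi> i. \<phi> \<in> C \<Longrightarrow> i \<in> J \<Longrightarrow> partially_differentiable i \<phi>"
    and closed: "\<And>\<phi> i. \<phi> \<in> C \<Longrightarrow> i \<in> J \<Longrightarrow> partial_der i \<phi> \<in> C"
  shows "smooth_in J \<psi>"
proof -
  have "foldr partial_der is \<psi> \<in> C" if "set is \<subseteq> J" for "is"
    using that by (induction "is") (auto simp: assms(1) closed)
  then show ?thesis unfolding smooth_in_iff using assms by blast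
qed

text \<open>
  Everything that has to be recognised as smooth is a polynomial in coordinates and in given smooth
  functions, the latter possibly of fewer variables. By Leibniz' rule this class is closed under
  partial derivatives, so that coinduction applies to it.
\<close>
inductive_set smooth_algebra :: "nat set \<Rightarrow> ((nat \<Rightarrow> real) \<Rightarrow> real) set" for J where
  base: "smooth_in K \<psi> \<Longrightarrow> K \<subseteq> J \<Longrightarrow> \<psi> \<in> smooth_algebra J"
| const: "(\<lambda>_. c) \<in> smooth_algebra J"
| proj: "i \<in> J \<Longrightarrow> (\<lambda>y. y i) \<in> smooth_algebra J"
| add: "\<phi> \<in> smooth_algebra J \<Longrightarrow> \<psi> \<in> smooth_algebra J \<Longrightarrow> (\<lambda>y. \<phi> y + \<psi> y) \<in> smooth_algebra J"
| mult: "\<phi> \<in> smooth_algebra J \<Longrightarrow> \<psi> \<in> smooth_algebra J \<Longrightarrow> (\<lambda>y. \<phi> y * \<psi> y) \<in> smooth_algebra J"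

lemma partial_der_const: "partial_der i (\<lambda>_. c) = (\<lambda>_. 0)"
  by (intro ext partial_der_eqI) simp

lemma coordinate_has_derivative:
  "((\<lambda>t. (y(i := t)) j) has_field_derivative (if i = j then 1 else 0)) (at s)" for y :: "nat \<Rightarrow> real"
  by auto

lemma partial_der_proj: "partial_der i (\<lambda>y. y j) = (\<lambda>_. if i = j then 1 else 0)"
  by (intro ext partial_der_eqI coordinate_has_derivative)

lemma partial_der_mult:
  assumes "partially_differentiable i \<phi>" "partially_differentiable i \<psi>"
  shows "partial_der i (\<lambda>y. \<phi> y * \<psi> y) = (\<lambda>y. partial_der i \<phi> y * \<psi> y + partial_der i \<psi> y * \<phi> y)"
proof (intro ext partial_der_eqI)
  fix y
  show "((\<lambda>t. \<phi> (y(i := t)) * \<psi> (y(i := t))) has_field_derivative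
    partial_der i \<phi> y * \<psi> y + partial_der i \<psi> y * \<phi> y) (at (y i))"
    using DERIV_mult[OF partially_differentiableD[OF assms(1), of y "y i"]
        partially_differentiableD[OF assms(2), of y "y i"]] by simp
qed

lemma partial_der_add:
  assumes "partially_differentiable i \<phi>" "partially_differentiable i \<psi>"
  shows "partial_der i (\<lambda>y. \<phi> y + \<psi> y) = (\<lambda>y. partial_der i \<phi> y + partial_der i \<psi> y)"
proof (intro ext partial_der_eqI)
  fix y
  show "((\<lambda>t. \<phi> (y(i := t)) + \<psi> (y(i := t))) has_field_derivative
    partial_der i \<phi> y + partial_der i \<psi> y) (at (y i))"
    using DERIV_add[OF partially_differentiableD[OF assms(1), of y "y i"]
        partially_differentiableD[OF assms(2), of y "y i"]] by simp
qed

lemma smooth_algebra_props: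
  assumes "\<psi> \<in> smooth_algebra J"
  shows "depends_on J \<psi> \<and> continuous_on UNIV \<psi> \<and>
    (\<forall>i\<in>J. partially_differentiable i \<psi> \<and> partial_der i \<psi> \<in> smooth_algebra J)"
  using assms
proof induction
  case (base K \<psi>)
  have dep: "depends_on K \<psi>" by (rule smooth_inD[OF base(1)])
  have "partially_differentiable i \<psi> \<and> partial_der i \<psi> \<in> smooth_algebra J" for i
  proof (cases "i \<in> K")
    case True
    then show ?thesis
      using smooth_inD(3)[OF base(1)] smooth_in_partial_der[OF base(1)] base(2)
      by (auto intro: smooth_algebra.base)
  next
    case False
    then show ?thesis using partial_der_outside[OF dep] by (auto intro: smooth_algebra.const)
  qed
  moreover have "depends_on J \<psi>" using dep base(2) unfolding depends_on_def by (meson subsetD)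
  ultimately show ?case using smooth_inD(2)[OF base(1)] by blast
next
  case (const c)
  show ?case
    by (auto simp: depends_on_def partial_der_const partially_differentiable_def intro:
        smooth_algebra.const)
next
  case (proj i)
  have "partially_differentiable j (\<lambda>y. y i)" for j
    unfolding partially_differentiable_def field_differentiable_def
    using coordinate_has_derivative by blast
  moreover have "continuous_on UNIV (\<lambda>y::nat \<Rightarrow> real. y i)" by simp
  ultimately show ?case
    using proj by (auto simp: depends_on_def partial_der_proj intro: smooth_algebra.const)
next
  case (add \<phi> \<psi>)
  have "partially_differentiable i (\<lambda>y. \<phi> y + \<psi> y)" if "i \<in> J" for i
    using add.IH that unfolding partially_differentiable_def
    by (auto intro!: field_differentiable_add)
  moreover have "depends_on J (\<lambda>y. \<phi> y + \<psi> y)"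
    using add.IH unfolding depends_on_def by metis
  ultimately show ?case
    using add.IH by (auto simp: partial_der_add intro!: continuous_on_add smooth_algebra.add)
next
  case (mult \<phi> \<psi>)
  have "partially_differentiable i (\<lambda>y. \<phi> y * \<psi> y)" if "i \<in> J" for i
    using mult.IH that unfolding partially_differentiable_def
    by (auto intro!: field_differentiable_mult)
  moreover have "depends_on J (\<lambda>y. \<phi> y * \<psi> y)"
    using mult.IH unfolding depends_on_def by metis
  ultimately show ?case
    using mult.IH mult.hyps
    by (auto simp: partial_der_mult intro!: continuous_on_mult smooth_algebra.add smooth_algebra.mult)
qed

lemma smooth_algebra_imp_smooth_in: "\<psi> \<in> smooth_algebra J \<Longrightarrow> smooth_in J \<psi>"
  by (rule smooth_in_coinduct[of _ "smooth_algebra J"]) (auto dest: smooth_algebra_props)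

lemma smooth_algebra_sum:
  "finite S \<Longrightarrow> (\<And>i. i \<in> S \<Longrightarrow> \<phi> i \<in> smooth_algebra J) \<Longrightarrow> (\<lambda>y. \<Sum>i\<in>S. \<phi> i y) \<in> smooth_algebra J"
  by (induction S rule: finite_induct) (auto intro: smooth_algebra.intros)

text \<open>
  One mean value argument in each of the two variables.  The mixed difference on the left is
  symmetric under exchange of \<open>i\<close> and \<open>j\<close>, the right-hand side is not a priori.
\<close>
lemma mixed_difference_mvt:
  assumes "smooth_in J \<psi>" "i \<in> J" "j \<in> J" "i \<noteq> j" "h > 0"
  shows "\<exists>s t. \<bar>s - a\<bar> \<le> h \<and> \<bar>t - b\<bar> \<le> h \<and>
    \<psi> (y(i := a + h, j := b + h)) - \<psi> (y(i := a + h, j := b))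
      - \<psi> (y(i := a, j := b + h)) + \<psi> (y(i := a, j := b))
    = h\<^sup>2 * partial_der i (partial_der j \<psi>) (y(i := s, j := t))"
proof -
  have pj: "partially_differentiable j \<psi>" using smooth_inD(3)[OF assms(1)] assms(3) .
  have pij: "partially_differentiable i (partial_der j \<psi>)"
    using smooth_inD(3)[OF smooth_in_partial_der[OF assms(1,3)]] assms(2) .
  define w where "w t = \<psi> (y(i := a + h, j := t)) - \<psi> (y(i := a, j := t))" for t
  have "(w has_field_derivative
      (partial_der j \<psi> (y(i := a + h, j := t)) - partial_der j \<psi> (y(i := a, j := t)))) (at t)" for t
    unfolding w_def by (intro DERIV_diff partially_differentiableD pj)
  then obtain t where t: "b < t" "t < b + h" and wt: "w (b + h) - w b =
      (b + h - b) * (partial_der j \<psi> (y(i := a + h, j := t)) - partial_der j \<psi> (y(i := a, j := t)))"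
    using MVT2[of b "b + h" w] assms(5) by force
  have "((\<lambda>s. partial_der j \<psi> (y(i := s, j := t))) has_field_derivative
      partial_der i (partial_der j \<psi>) (y(i := s, j := t))) (at s)" for s
    using partially_differentiableD[OF pij, of "y(j := t)" s] by (simp add: fun_upd_twist[OF assms(4)])
  then obtain s where s: "a < s" "s < a + h"
    and ws: "partial_der j \<psi> (y(i := a + h, j := t)) - partial_der j \<psi> (y(i := a, j := t))
      = (a + h - a) * partial_der i (partial_der j \<psi>) (y(i := s, j := t))"
    using MVT2[of a "a + h" "\<lambda>s. partial_der j \<psi> (y(i := s, j := t))"] assms(5) by force
  show ?thesis
    using s t wt ws unfolding w_def by (intro exI[of _ s] exI[of _ t]) (auto simp: power2_eq_square)
qed

text \<open>
  Schwarz' theorem: by the previous lemma the mixed difference quotient of step \<open>1 / Suc n\<close> is a value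
      of either
  iterated derivative at a point that converges to \<open>y\<close>, so both derivatives at \<open>y\<close> are its limit.
\<close>
lemma partial_der_commute:
  assumes "smooth_in J \<psi>" "i \<in> J" "j \<in> J"
  shows "partial_der i (partial_der j \<psi>) = partial_der j (partial_der i \<psi>)"
proof (cases "i = j")
  case False
  show ?thesis
  proof
    fix y :: "nat \<Rightarrow> real"
    define a where "a = y i"
    define b where "b = y j"
    define D where "D h = \<psi> (y(i := a + h, j := b + h)) - \<psi> (y(i := a + h, j := b))
      - \<psi> (y(i := a, j := b + h)) + \<psi> (y(i := a, j := b))" for h
    have lim: "(\<lambda>n. D (1 / Suc n) / (1 / Suc n)\<^sup>2) \<longlonglongrightarrow> \<theta> y"
      if cont: "continuous_on UNIV \<theta>"
        and mv: "\<And>h. h > 0 \<Longrightarrow> \<exists>s t. \<bar>s - a\<bar> \<le> h \<and> \<bar>t - b\<bar> \<le> h \<and> D h = h\<^sup>2 * \<theta> (y(i := s, j := t))" for \<theta>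
    proof -
      have "\<forall>n. \<exists>s t. \<bar>s - a\<bar> \<le> 1 / Suc n \<and> \<bar>t - b\<bar> \<le> 1 / Suc n \<and>
          D (1 / Suc n) = (1 / Suc n)\<^sup>2 * \<theta> (y(i := s, j := t))"
        by (intro allI mv) simp
      then obtain s t where s: "\<And>n. \<bar>s n - a\<bar> \<le> 1 / Suc n" and t: "\<And>n. \<bar>t n - b\<bar> \<le> 1 / Suc n"
        and D: "\<And>n. D (1 / Suc n) = (1 / Suc n)\<^sup>2 * \<theta> (y(i := s n, j := t n))" by metis
      have inv: "(\<lambda>n. 1 / real (Suc n)) \<longlonglongrightarrow> 0"
        using LIMSEQ_inverse_real_of_nat by (simp add: inverse_eq_divide)
      have slim: "s \<longlonglongrightarrow> a"
        by (rule Lim_transform2[OF tendsto_const], rule Lim_null_comparison[OF _ inv])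
           (use s in \<open>auto simp: abs_minus_commute\<close>)
      have tlim: "t \<longlonglongrightarrow> b"
        by (rule Lim_transform2[OF tendsto_const], rule Lim_null_comparison[OF _ inv])
           (use t in \<open>auto simp: abs_minus_commute\<close>)
      have "continuous_on UNIV (\<lambda>p::real \<times> real. y(i := fst p, j := snd p))"
      proof (rule continuous_on_coordinatewise_then_product)
        fix k show "continuous_on UNIV (\<lambda>p::real \<times> real. (y(i := fst p, j := snd p)) k)"
          by (cases "k = j"; cases "k = i") (auto intro!: continuous_intros)
      qed
      then have "continuous_on UNIV (\<lambda>p::real \<times> real. \<theta> (y(i := fst p, j := snd p)))"
        using continuous_on_compose2[OF cont] by blast
      then have "(\<lambda>n. \<theta> (y(i := fst (s n, t n), j := snd (s n, t n)))) \<longlonglongrightarrow> \<theta> (y(i := fst (a, b), j := snd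
          (a, b)))"
        by (intro continuous_on_tendsto_compose[where f="\<lambda>p::real \<times> real. \<theta> (y(i := fst p, j := snd
            p))"] tendsto_Pair slim tlim) auto
      moreover have "y(i := a, j := b) = y" by (simp add: a_def b_def)
      moreover have "D (1 / Suc n) / (1 / Suc n)\<^sup>2 = \<theta> (y(i := s n, j := t n))" for n
        by (subst D) simp
      ultimately show ?thesis by simp
    qed
    have "(\<lambda>n. D (1 / Suc n) / (1 / Suc n)\<^sup>2) \<longlonglongrightarrow> partial_der i (partial_der j \<psi>) y"
    proof (rule lim)
      show "continuous_on UNIV (partial_der i (partial_der j \<psi>))"
        by (rule smooth_inD(2)[OF smooth_in_partial_der[OF smooth_in_partial_der[OF assms(1,3)] assms(2)]])
    next
      fix h :: real assume "h > 0"
      from mixed_difference_mvt[OF assms False this, of a b y]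
      show "\<exists>s t. \<bar>s - a\<bar> \<le> h \<and> \<bar>t - b\<bar> \<le> h \<and> D h = h\<^sup>2 * partial_der i (partial_der j \<psi>) (y(i := s, j
          := t))"
        unfolding D_def .
    qed
    moreover have "(\<lambda>n. D (1 / Suc n) / (1 / Suc n)\<^sup>2) \<longlonglongrightarrow> partial_der j (partial_der i \<psi>) y"
    proof (rule lim)
      show "continuous_on UNIV (partial_der j (partial_der i \<psi>))"
        by (rule smooth_inD(2)[OF smooth_in_partial_der[OF smooth_in_partial_der[OF assms(1,2)] assms(3)]])
    next
      fix h :: real assume "h > 0"
      from mixed_difference_mvt[OF assms(1,3,2) False[symmetric] this, of b a y]
      obtain t s where "\<bar>t - b\<bar> \<le> h" "\<bar>s - a\<bar> \<le> h" and eq: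
          "\<psi> (y(j := b + h, i := a + h)) - \<psi> (y(j := b + h, i := a))
            - \<psi> (y(j := b, i := a + h)) + \<psi> (y(j := b, i := a))
          = h\<^sup>2 * partial_der j (partial_der i \<psi>) (y(j := t, i := s))" by blast
      moreover have "D h = h\<^sup>2 * partial_der j (partial_der i \<psi>) (y(i := s, j := t))"
        using eq unfolding D_def fun_upd_twist[OF False[symmetric]] by simp
      ultimately
      show "\<exists>s t. \<bar>s - a\<bar> \<le> h \<and> \<bar>t - b\<bar> \<le> h \<and> D h = h\<^sup>2 * partial_der j (partial_der i \<psi>) (y(i := s, j
          := t))"
        by blast
    qed
    ultimately show "partial_der i (partial_der j \<psi>) y = partial_der j (partial_der i \<psi>) y"
      by (rule LIMSEQ_unique)
  qed
qed simp

section \<open>Chain and product rules for a diffusion operator\<close>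

text \<open>
  The functionals \<open>f \<mapsto> L f x\<close>, \<open>f \<mapsto> \<Gamma>(f, h)(x)\<close> and \<open>g \<mapsto> H\<^sub>f(g, h)(x)\<close> are all used in this form, to
  exchange them with finite sums.
\<close>
definition linear_on :: "('a \<Rightarrow> real) set \<Rightarrow> (('a \<Rightarrow> real) \<Rightarrow> real) \<Rightarrow> bool" where
  "linear_on A T \<longleftrightarrow> (\<forall>f\<in>A. \<forall>g\<in>A. T (f + g) = T f + T g) \<and> (\<forall>c. \<forall>f\<in>A. T (\<lambda>y. c * f y) = c * T f)"

context diffusion_operator
begin

lemma add_mem': "f \<in> A \<Longrightarrow> g \<in> A \<Longrightarrow> (\<lambda>y. f y + g y) \<in> A"
  using add_mem[of f g] by (simp add: plus_fun_def)

lemma mult_mem': "f \<in> A \<Longrightarrow> g \<in> A \<Longrightarrow> (\<lambda>y. f y * g y) \<in> A"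
  using mult_mem[of f g] by (simp add: times_fun_def)

lemma diff_mem': "f \<in> A \<Longrightarrow> g \<in> A \<Longrightarrow> (\<lambda>y. f y - g y) \<in> A"
  using add_mem'[of f "\<lambda>y. - 1 * g y"] scale_mem[of g "-1"] by simp

lemma diff_mem: "f \<in> A \<Longrightarrow> g \<in> A \<Longrightarrow> f - g \<in> A"
  using diff_mem'[of f g] by (simp add: fun_diff_def)

lemma Gam_mem: "f \<in> A \<Longrightarrow> g \<in> A \<Longrightarrow> Gam L f g \<in> A"
  using scale_mem[of "\<lambda>x. L (f * g) x - f x * L g x - g x * L f x" "1/2"]
  unfolding Gam_def[abs_def] by (simp add: diff_mem' mult_mem' mult_mem L_mem)

lemma sum_mem: "finite S \<Longrightarrow> (\<And>i. i \<in> S \<Longrightarrow> G i \<in> A) \<Longrightarrow> (\<lambda>y. \<Sum>i\<in>S. G i y) \<in> A"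
  by (induction S rule: finite_induct) (use zero_mem in \<open>auto simp: zero_fun_def add_mem'\<close>)

lemma linear_on_sum:
  assumes T: "linear_on A T" and S: "finite S" "\<And>i. i \<in> S \<Longrightarrow> G i \<in> A"
  shows "T (\<lambda>y. \<Sum>i\<in>S. G i y) = (\<Sum>i\<in>S. T (G i))"
  using S
proof (induction S rule: finite_induct)
  case empty
  have "T (\<lambda>y. 0 * 0 y) = 0 * T 0" using T zero_mem unfolding linear_on_def by blast
  then show ?case by simp
next
  case (insert i S)
  then have "T (G i + (\<lambda>y. \<Sum>i\<in>S. G i y)) = T (G i) + T (\<lambda>y. \<Sum>i\<in>S. G i y)"
    using T sum_mem[of S G] unfolding linear_on_def by simp
  then show ?case using insert by (simp add: plus_fun_def)
qed

lemma linear_on_sum_scaled: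
  assumes T: "linear_on A T" and S: "finite S" "\<And>i. i \<in> S \<Longrightarrow> G i \<in> A"
  shows "T (\<lambda>y. \<Sum>i\<in>S. c i * G i y) = (\<Sum>i\<in>S. c i * T (G i))"
proof -
  have "T (\<lambda>y. \<Sum>i\<in>S. c i * G i y) = (\<Sum>i\<in>S. T (\<lambda>y. c i * G i y))"
    by (rule linear_on_sum[OF T]) (auto intro: S scale_mem)
  also have "\<dots> = (\<Sum>i\<in>S. c i * T (G i))"
    by (rule sum.cong) (use T S in \<open>auto simp: linear_on_def\<close>)
  finally show ?thesis .
qed

lemma linear_on_L: "linear_on A (\<lambda>f. L f x)"
  unfolding linear_on_def by (simp add: L_add L_scale)

lemma Gam_commute: "Gam L f g = Gam L g f"
  unfolding Gam_def[abs_def] by (auto simp: mult.commute)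

lemma Gam_add_left:
  assumes "f \<in> A" "g \<in> A" "h \<in> A" shows "Gam L (f + g) h x = Gam L f h x + Gam L g h x"
proof -
  have "(f + g) * h = f * h + g * h" by (auto simp: algebra_simps)
  then have "L ((f + g) * h) x = L (f * h) x + L (g * h) x" using assms by (simp add: L_add mult_mem)
  moreover have "L (f + g) x = L f x + L g x" using assms by (simp add: L_add)
  ultimately show ?thesis unfolding Gam_def plus_fun_apply by (simp add: field_simps)
qed

lemma Gam_scale_left:
  assumes "f \<in> A" "h \<in> A" shows "Gam L (\<lambda>y. c * f y) h x = c * Gam L f h x"
proof -
  have "(\<lambda>y. c * f y) * h = (\<lambda>y. c * (f * h) y)" by (auto simp: algebra_simps)
  then have "L ((\<lambda>y. c * f y) * h) x = c * L (f * h) x"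
    using L_scale[OF mult_mem[OF assms]] by metis
  moreover have "L (\<lambda>y. c * f y) x = c * L f x" using assms by (simp add: L_scale)
  ultimately show ?thesis unfolding Gam_def by (simp add: field_simps)
qed

lemma linear_on_Gam_left: "h \<in> A \<Longrightarrow> linear_on A (\<lambda>f. Gam L f h x)"
  unfolding linear_on_def by (simp add: Gam_add_left Gam_scale_left)

lemma linear_on_Gam_right: "h \<in> A \<Longrightarrow> linear_on A (\<lambda>f. Gam L h f x)"
  unfolding Gam_commute[of h] by (rule linear_on_Gam_left)

lemma Gam_add_right:
  "f \<in> A \<Longrightarrow> g \<in> A \<Longrightarrow> h \<in> A \<Longrightarrow> Gam L h (f + g) x = Gam L h f x + Gam L h g x"
  using linear_on_Gam_right unfolding linear_on_def by blast

lemma Gam_scale_right: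
  "f \<in> A \<Longrightarrow> h \<in> A \<Longrightarrow> Gam L h (\<lambda>y. c * f y) x = c * Gam L h f x"
  using linear_on_Gam_right unfolding linear_on_def by blast

lemma Gam_self_add:
  assumes "f \<in> A" "g \<in> A"
  shows "Gam L (f + g) (f + g) x = Gam L f f x + 2 * Gam L f g x + Gam L g g x"
  using assms Gam_commute[of g f] by (simp add: Gam_add_left Gam_add_right add_mem)

text \<open>
  The chain rule requires a function that vanishes at the origin, which the partial derivatives of
  \<open>\<psi>\<close> do not. Multiplied by one more coordinate, they do: the lemma is the chain rule for
  \<open>\<psi>(y) y\<^sub>r\<close>, with the additional function \<open>v\<close> put into the slot \<open>r\<close>.
\<close>
lemma L_smooth_mult:
  assumes F: "\<forall>i<r. F i \<in> A" and v: "v \<in> A" and \<psi>: "smooth_in {..<r} \<psi>"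
  shows "(\<lambda>y. \<psi> (\<lambda>i. F i y) * v y) \<in> A"
    and "L (\<lambda>y. \<psi> (\<lambda>i. F i y) * v y) x =
      \<psi> (\<lambda>i. F i x) * L v x +
      v x * ((\<Sum>i<r. partial_der i \<psi> (\<lambda>k. F k x) * L (F i) x) +
        (\<Sum>i<r. \<Sum>j<r. partial_der j (partial_der i \<psi>) (\<lambda>k. F k x) * Gam L (F i) (F j) x)) +
      2 * (\<Sum>i<r. partial_der i \<psi> (\<lambda>k. F k x) * Gam L v (F i) x)"
proof -
  define K where "K = F(r := v)"
  have Kr: "K r = v" by (simp add: K_def)
  have Ki: "K i = F i" if "i < r" for i using that by (simp add: K_def)
  define \<phi> where "\<phi> y = \<psi> y * y r" for y :: "nat \<Rightarrow> real"
  have K: "\<forall>i<Suc r. K i \<in> A" using F v by (auto simp: K_def less_Suc_eq)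
  have \<psi>alg: "\<psi> \<in> smooth_algebra {..<Suc r}"
    by (rule smooth_algebra.base[OF \<psi>]) auto
  have "\<phi> \<in> smooth_algebra {..<Suc r}"
    unfolding \<phi>_def by (intro smooth_algebra.mult \<psi>alg smooth_algebra.proj) simp
  then have \<phi>: "smooth_in {..<Suc r} \<phi>" by (rule smooth_algebra_imp_smooth_in)
  have \<phi>0: "\<phi> (\<lambda>_. 0) = 0" by (simp add: \<phi>_def)
  have ev: "\<theta> (\<lambda>i. K i y) = \<theta> (\<lambda>i. F i y)" if "depends_on {..<r} \<theta>" for \<theta> y
    using that unfolding depends_on_def K_def by auto
  have fn: "(\<lambda>y. \<phi> (\<lambda>i. K i y)) = (\<lambda>y. \<psi> (\<lambda>i. F i y) * v y)"
    using ev[OF smooth_inD(1)[OF \<psi>]] by (simp add: \<phi>_def K_def)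
  show "(\<lambda>y. \<psi> (\<lambda>i. F i y) * v y) \<in> A"
    using comp_mem[OF K \<phi> \<phi>0] by (simp add: fn)
  have prj: "(\<lambda>y::nat\<Rightarrow>real. y r) \<in> smooth_algebra {..<Suc r}" by (rule smooth_algebra.proj) simp
  have pdalg: "partially_differentiable i \<theta>" if "\<theta> \<in> smooth_algebra {..<Suc r}" "i < Suc r" for \<theta> i
    using smooth_algebra_props[OF that(1)] that(2) by auto
  have D1: "partial_der i \<phi> = (\<lambda>y. partial_der i \<psi> y * y r + (if i = r then 1 else 0) * \<psi> y)"
    if "i < Suc r" for i
    unfolding \<phi>_def using that by (simp add: partial_der_mult pdalg \<psi>alg prj partial_der_proj)
  have Dr: "partial_der r \<psi> = (\<lambda>_. 0)"
    by (rule partial_der_outside[OF smooth_inD(1)[OF \<psi>]]) simp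
  have D1r: "partial_der r \<phi> = \<psi>" using D1[of r] by (simp add: Dr)
  have D1i: "partial_der i \<phi> = (\<lambda>y. partial_der i \<psi> y * y r)" if "i < r" for i
    using D1[of i] that by simp
  have \<psi>i: "smooth_in {..<r} (partial_der i \<psi>)" if "i < r" for i
    using smooth_in_partial_der[OF \<psi>] that by simp
  have \<psi>ialg: "partial_der i \<psi> \<in> smooth_algebra {..<Suc r}" if "i < r" for i
    by (rule smooth_algebra.base[OF \<psi>i[OF that]]) auto
  have D2: "partial_der j (partial_der i \<phi>) =
      (\<lambda>y. partial_der j (partial_der i \<psi>) y * y r + (if j = r then 1 else 0) * partial_der i \<psi> y)"
    if "i < r" "j < Suc r" for i j
    unfolding D1i[OF that(1)] using that by (simp add: partial_der_mult pdalg \<psi>ialg prj partial_der_proj)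
  have D2r: "partial_der r (partial_der i \<phi>) = partial_der i \<psi>" if "i < r" for i
    using D2[of i r] that partial_der_outside(1)[OF smooth_inD(1)[OF \<psi>i[OF that]], of r] by simp
  have D2j: "partial_der j (partial_der i \<phi>) = (\<lambda>y. partial_der j (partial_der i \<psi>) y * y r)"
    if "i < r" "j < r" for i j using D2[of i j] that by simp
  have dep1: "depends_on {..<r} (partial_der i \<psi>)" if "i < r" for i
    using smooth_inD(1)[OF \<psi>i[OF that]] .
  have dep2: "depends_on {..<r} (partial_der j (partial_der i \<psi>))" if "i < r" "j < r" for i j
    using smooth_inD(1)[OF smooth_in_partial_der[OF \<psi>i[OF that(1)]]] that by simp
  have ev1: "partial_der i \<psi> (\<lambda>k. K k x) = partial_der i \<psi> (\<lambda>k. F k x)" if "i < r" for i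
    by (rule ev[OF dep1[OF that]])
  have ev2: "partial_der j (partial_der i \<psi>) (\<lambda>k. K k x) = partial_der j (partial_der i \<psi>) (\<lambda>k. F k x)"
    if "i < r" "j < r" for i j
    by (rule ev[OF dep2[OF that]])
  have ev0: "\<psi> (\<lambda>k. K k x) = \<psi> (\<lambda>k. F k x)" by (rule ev[OF smooth_inD(1)[OF \<psi>]])
  have first: "(\<Sum>i<Suc r. partial_der i \<phi> (\<lambda>k. K k x) * L (K i) x) =
      v x * (\<Sum>i<r. partial_der i \<psi> (\<lambda>k. F k x) * L (F i) x) + \<psi> (\<lambda>k. F k x) * L v x"
  proof -
    have "(\<Sum>i<r. partial_der i \<phi> (\<lambda>k. K k x) * L (K i) x) =
        (\<Sum>i<r. v x * (partial_der i \<psi> (\<lambda>k. F k x) * L (F i) x))"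
      by (rule sum.cong) (simp_all add: D1i ev1 Kr Ki)
    then show ?thesis by (simp add: D1r ev0 Kr sum_distrib_left)
  qed
  have row: "(\<Sum>j<Suc r. partial_der j (partial_der i \<phi>) (\<lambda>k. K k x) * Gam L (K i) (K j) x) =
      v x * (\<Sum>j<r. partial_der j (partial_der i \<psi>) (\<lambda>k. F k x) * Gam L (F i) (F j) x) +
      partial_der i \<psi> (\<lambda>k. F k x) * Gam L v (F i) x" if "i < r" for i
    using that Gam_commute[of v "F i"]
  proof -
    have "(\<Sum>j<r. partial_der j (partial_der i \<phi>) (\<lambda>k. K k x) * Gam L (K i) (K j) x) =
        (\<Sum>j<r. v x * (partial_der j (partial_der i \<psi>) (\<lambda>k. F k x) * Gam L (F i) (F j) x))"
      by (rule sum.cong) (simp_all add: D2j that ev2 Kr Ki)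
    then show ?thesis
      by (simp add: D2r that ev1 Kr Ki sum_distrib_left Gam_commute[of v "F i"])
  qed
  have last: "(\<Sum>j<Suc r. partial_der j (partial_der r \<phi>) (\<lambda>k. K k x) * Gam L (K r) (K j) x) =
      (\<Sum>j<r. partial_der j \<psi> (\<lambda>k. F k x) * Gam L v (F j) x)"
  proof -
    have "(\<Sum>j<r. partial_der j (partial_der r \<phi>) (\<lambda>k. K k x) * Gam L (K r) (K j) x) =
        (\<Sum>j<r. partial_der j \<psi> (\<lambda>k. F k x) * Gam L v (F j) x)"
      by (rule sum.cong) (simp_all add: D1r ev1 Kr Ki)
    then show ?thesis by (simp add: D1r Dr)
  qed
  have second: "(\<Sum>i<Suc r. \<Sum>j<Suc r. partial_der j (partial_der i \<phi>) (\<lambda>k. K k x) * Gam L (K i) (K j) x) =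
     v x * (\<Sum>i<r. \<Sum>j<r. partial_der j (partial_der i \<psi>) (\<lambda>k. F k x) * Gam L (F i) (F j) x) +
      2 * (\<Sum>i<r. partial_der i \<psi> (\<lambda>k. F k x) * Gam L v (F i) x)"
  proof -
    have "(\<Sum>i<r. \<Sum>j<Suc r. partial_der j (partial_der i \<phi>) (\<lambda>k. K k x) * Gam L (K i) (K j) x) =
      (\<Sum>i<r. v x * (\<Sum>j<r. partial_der j (partial_der i \<psi>) (\<lambda>k. F k x) * Gam L (F i) (F j) x) +
        partial_der i \<psi> (\<lambda>k. F k x) * Gam L v (F i) x)"
      by (rule sum.cong) (simp_all add: row del: sum.lessThan_Suc)
    then show ?thesis
      unfolding sum.lessThan_Suc[of _ r, where g="\<lambda>i. \<Sum>j<Suc r. partial_der j (partial_der i \<phi>) (\<lambda>k. K k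
          x) * Gam L (K i) (K j) x"] last
      by (simp add: sum.distrib sum_distrib_left)
  qed
  show "L (\<lambda>y. \<psi> (\<lambda>i. F i y) * v y) x =
      \<psi> (\<lambda>i. F i x) * L v x +
      v x * ((\<Sum>i<r. partial_der i \<psi> (\<lambda>k. F k x) * L (F i) x) +
        (\<Sum>i<r. \<Sum>j<r. partial_der j (partial_der i \<psi>) (\<lambda>k. F k x) * Gam L (F i) (F j) x)) +
      2 * (\<Sum>i<r. partial_der i \<psi> (\<lambda>k. F k x) * Gam L v (F i) x)"
    using chain_rule[OF K \<phi> \<phi>0, of x] unfolding fn first second by (simp add: algebra_simps)
qed

text \<open>
  Compare the product rule of the previous lemma for \<open>\<psi>(F) f\<close> with the chain rule for \<open>\<psi>(F)\<close>:
  the second derivatives of \<open>\<psi>\<close> cancel, and \<open>\<Gamma>(f, \<cdot>)\<close> is a derivation.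
\<close>
lemma Gam_smooth:
  assumes F: "\<forall>i<r. F i \<in> A" and f: "f \<in> A" and \<psi>: "smooth_in {..<r} \<psi>" "\<psi> (\<lambda>_. 0) = 0"
  shows "Gam L f (\<lambda>y. \<psi> (\<lambda>i. F i y)) x = (\<Sum>i<r. partial_der i \<psi> (\<lambda>k. F k x) * Gam L f (F i) x)"
proof -
  have "f * (\<lambda>y. \<psi> (\<lambda>i. F i y)) = (\<lambda>y. \<psi> (\<lambda>i. F i y) * f y)" by auto
  then show ?thesis
    unfolding Gam_def[of L f "\<lambda>y. \<psi> (\<lambda>i. F i y)"]
    by (simp only: L_smooth_mult(2)[OF F f \<psi>(1)] chain_rule[OF F \<psi>]) (simp add: algebra_simps)
qed

lemma Gam_Leibniz:
  assumes "f \<in> A" "g \<in> A" "h \<in> A"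
  shows "Gam L f (g * h) x = g x * Gam L f h x + h x * Gam L f g x"
proof -
  define F where "F = (\<lambda>i::nat. if i = 0 then g else h)"
  define \<psi> where "\<psi> = (\<lambda>y::nat \<Rightarrow> real. y 0 * y 1)"
  have F: "\<forall>i<2. F i \<in> A" using assms by (simp add: F_def)
  have "\<psi> \<in> smooth_algebra {..<2}" unfolding \<psi>_def by (intro smooth_algebra.intros) auto
  then have \<psi>: "smooth_in {..<2} \<psi>" by (rule smooth_algebra_imp_smooth_in)
  have pd: "partially_differentiable i (\<lambda>y. y j)" for i j
    unfolding partially_differentiable_def field_differentiable_def
    using coordinate_has_derivative by blast
  have D: "partial_der 0 \<psi> = (\<lambda>y. y 1)" "partial_der (Suc 0) \<psi> = (\<lambda>y. y 0)"
    unfolding \<psi>_def by (simp_all add: partial_der_mult pd partial_der_proj)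
  have "Gam L f (\<lambda>y. \<psi> (\<lambda>i. F i y)) x = (\<Sum>i<2. partial_der i \<psi> (\<lambda>k. F k x) * Gam L f (F i) x)"
    by (rule Gam_smooth[OF F assms(1) \<psi>]) (simp add: \<psi>_def)
  moreover have "(\<lambda>y. \<psi> (\<lambda>i. F i y)) = g * h" by (auto simp: \<psi>_def F_def)
  ultimately show ?thesis by (simp add: numeral_2_eq_2 D) (simp add: F_def)
qed

text \<open>
  The derivation property again, for the coefficients \<open>\<psi>(F)\<close> that need not vanish at the origin and
  therefore need not lie in \<open>A\<close>.
\<close>
lemma Gam_smooth_mult:
  assumes F: "\<forall>i<r. F i \<in> A" and f: "f \<in> A" and v: "v \<in> A" and \<psi>: "smooth_in {..<r} \<psi>"
  shows "Gam L f (\<lambda>y. \<psi> (\<lambda>i. F i y) * v y) x =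
    \<psi> (\<lambda>i. F i x) * Gam L f v x + v x * (\<Sum>i<r. partial_der i \<psi> (\<lambda>k. F k x) * Gam L f (F i) x)"
proof -
  have eq: "f * (\<lambda>y. \<psi> (\<lambda>i. F i y) * v y) = (\<lambda>y. \<psi> (\<lambda>i. F i y) * (f * v) y)" by auto
  have "Gam L (f * v) (F i) x = f x * Gam L v (F i) x + v x * Gam L f (F i) x" if "i < r" for i
    using Gam_Leibniz[of "F i" f v x] F f v that by (simp add: Gam_commute[of "F i"])
  then have s: "(\<Sum>i<r. partial_der i \<psi> (\<lambda>k. F k x) * Gam L (f * v) (F i) x) =
      f x * (\<Sum>i<r. partial_der i \<psi> (\<lambda>k. F k x) * Gam L v (F i) x) +
      v x * (\<Sum>i<r. partial_der i \<psi> (\<lambda>k. F k x) * Gam L f (F i) x)"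
    unfolding sum_distrib_left sum.distrib[symmetric]
    by (intro sum.cong) (simp_all add: algebra_simps)
  have fv: "L (f * v) x = 2 * Gam L f v x + f x * L v x + v x * L f x" by (simp add: Gam_def field_simps)
  show ?thesis
    unfolding Gam_def[of L f "\<lambda>y. \<psi> (\<lambda>i. F i y) * v y"] eq
      L_smooth_mult(2)[OF F mult_mem[OF f v] \<psi>] L_smooth_mult(2)[OF F v \<psi>] s fv
    by (simp add: algebra_simps)
qed

section \<open>Second-order perturbations at a point\<close>

lemma Gam_add_fun: "f \<in> A \<Longrightarrow> g \<in> A \<Longrightarrow> h \<in> A \<Longrightarrow> Gam L h (f + g) = Gam L h f + Gam L h g"
  by (intro ext) (simp add: Gam_add_right)

lemma Gam_scale_fun: "f \<in> A \<Longrightarrow> h \<in> A \<Longrightarrow> Gam L h (\<lambda>y. c * f y) = (\<lambda>y. c * Gam L h f y)"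
  by (intro ext) (simp add: Gam_scale_right)

lemma Hess_commute: "Hess L f g h x = Hess L f h g x"
  unfolding Hess_def by (simp add: Gam_commute[of g h])

lemma linear_on_Hess:
  assumes "f \<in> A" "h \<in> A" shows "linear_on A (\<lambda>g. Hess L f g h x)"
  unfolding linear_on_def Hess_def
  using assms
  by (auto simp: Gam_add_left Gam_add_right Gam_add_fun Gam_scale_left Gam_scale_right Gam_scale_fun
      Gam_mem add_divide_distrib diff_divide_distrib right_diff_distrib distrib_left Gam_commute[of _ h])

lemma Gam2_add:
  assumes "f \<in> A" "g \<in> A"
  shows "Gam2 L (f + g) (f + g) x = Gam2 L f f x + 2 * Gam2 L f g x + Gam2 L g g x"
proof -
  have "Gam L (f + g) (f + g) = Gam L f f + ((\<lambda>y. 2 * Gam L f g y) + Gam L g g)"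
    by (intro ext) (simp add: Gam_self_add assms)
  then have "L (Gam L (f + g) (f + g)) x = L (Gam L f f) x + 2 * L (Gam L f g) x + L (Gam L g g) x"
    using assms by (simp add: L_add L_scale Gam_mem add_mem scale_mem)
  moreover have "Gam L (f + g) (L (f + g)) x =
      Gam L f (L f) x + Gam L f (L g) x + Gam L g (L f) x + Gam L g (L g) x"
    using assms by (simp add: L_add L_mem Gam_add_left Gam_add_right add_mem)
  ultimately show ?thesis by (simp add: Gam2_def field_simps)
qed

lemma sum_rotate3:
  "(\<Sum>i\<in>S. \<Sum>j\<in>S. \<Sum>k\<in>S. T i j k) = (\<Sum>i\<in>S. \<Sum>j\<in>S. \<Sum>k\<in>S. T j k i)" for T :: "'i \<Rightarrow> 'i \<Rightarrow> 'i \<Rightarrow> real"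
proof -
  have "(\<Sum>i\<in>S. \<Sum>j\<in>S. \<Sum>k\<in>S. T j k i) = (\<Sum>j\<in>S. \<Sum>i\<in>S. \<Sum>k\<in>S. T j k i)"
    by (rule sum.swap)
  also have "\<dots> = (\<Sum>j\<in>S. \<Sum>k\<in>S. \<Sum>i\<in>S. T j k i)"
    by (intro sum.cong sum.swap refl)
  finally show ?thesis by simp
qed

text \<open>
  At a point where all \<open>\<psi>\<^sub>i(F)\<close> vanish, the iterated operators in \<open>\<Gamma>\<^sub>2(f, \<psi>(F))\<close> produce terms with
  \<open>\<psi>\<^sub>i\<^sub>j\<close> and with \<open>\<psi>\<^sub>i\<^sub>j\<^sub>k\<close>. By the symmetry of the second and third derivatives, the terms with
  \<open>L F\<^sub>i\<close> and those with \<open>\<psi>\<^sub>i\<^sub>j\<^sub>k\<close> cancel, and what is left is the contraction of \<open>\<psi>\<^sub>i\<^sub>j\<close> with the Hessian.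
\<close>
lemma Gam2_smooth:
  assumes F: "\<forall>i<r. F i \<in> A" and f: "f \<in> A" and \<psi>: "smooth_in {..<r} \<psi>" "\<psi> (\<lambda>_. 0) = 0"
    and crit: "\<forall>i<r. partial_der i \<psi> (\<lambda>k. F k x) = 0"
  shows "Gam2 L f (\<lambda>y. \<psi> (\<lambda>i. F i y)) x =
    (\<Sum>i<r. \<Sum>j<r. partial_der j (partial_der i \<psi>) (\<lambda>k. F k x) * Hess L f (F i) (F j) x)"
proof -
  define g where "g = (\<lambda>y. \<psi> (\<lambda>i. F i y))"
  define a where "a i j = partial_der j (partial_der i \<psi>) (\<lambda>k. F k x)" for i j
  define c where "c i j k = partial_der k (partial_der j (partial_der i \<psi>)) (\<lambda>k. F k x)" for i j k
  define G where "G i j = Gam L (F i) (F j) x" for i j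
  define v where "v i = Gam L f (F i)" for i
  have g: "g \<in> A" unfolding g_def by (rule comp_mem[OF F \<psi>])
  have F': "F i \<in> A" if "i < r" for i using F that by blast
  have v: "v i \<in> A" if "i < r" for i unfolding v_def using f F' that by (simp add: Gam_mem)
  have \<psi>i: "smooth_in {..<r} (partial_der i \<psi>)" if "i < r" for i
    using smooth_in_partial_der[OF \<psi>(1)] that by simp
  have \<psi>ij: "smooth_in {..<r} (partial_der j (partial_der i \<psi>))" if "i < r" "j < r" for i j
    using smooth_in_partial_der[OF \<psi>i] that by simp
  have D2: "partial_der j (partial_der i \<psi>) = partial_der i (partial_der j \<psi>)" if "i < r" "j < r" for i j
    using partial_der_commute[OF \<psi>(1)] that by simp
  have a_sym: "a i j = a j i" if "i < r" "j < r" for i j using D2[OF that] by (simp add: a_def)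
  have c_rot: "c j k i = c i j k" if "i < r" "j < r" "k < r" for i j k
  proof -
    have "partial_der i (partial_der k (partial_der j \<psi>)) = partial_der k (partial_der i (partial_der j \<psi>))"
      using partial_der_commute[OF \<psi>i[OF that(2)]] that by simp
    then show ?thesis unfolding c_def using D2[OF that(1,2)] by simp
  qed
  have Lfg: "L (Gam L f g) x = (\<Sum>i<r. v i x * (\<Sum>j<r. a i j * L (F j) x)) +
      (\<Sum>i<r. \<Sum>j<r. \<Sum>k<r. v i x * (c i j k * G j k)) + 2 * (\<Sum>i<r. \<Sum>j<r. a i j * Gam L (v i) (F j) x)"
  proof -
    have "Gam L f g = (\<lambda>y. \<Sum>i<r. partial_der i \<psi> (\<lambda>k. F k y) * v i y)"
      unfolding g_def v_def by (intro ext Gam_smooth F f \<psi>)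
    then have "L (Gam L f g) x = (\<Sum>i<r. L (\<lambda>y. partial_der i \<psi> (\<lambda>k. F k y) * v i y) x)"
      using linear_on_sum[OF linear_on_L, of "{..<r}" "\<lambda>i y. partial_der i \<psi> (\<lambda>k. F k y) * v i y" x]
        L_smooth_mult(1)[OF F v \<psi>i] by simp
    also have "\<dots> = (\<Sum>i<r. v i x * (\<Sum>j<r. a i j * L (F j) x) + (\<Sum>j<r. \<Sum>k<r. v i x * (c i j k * G j k))
        + 2 * (\<Sum>j<r. a i j * Gam L (v i) (F j) x))"
    proof (rule sum.cong)
      fix i assume "i \<in> {..<r}"
      then have i: "i < r" by simp
      show "L (\<lambda>y. partial_der i \<psi> (\<lambda>k. F k y) * v i y) x =
          v i x * (\<Sum>j<r. a i j * L (F j) x) + (\<Sum>j<r. \<Sum>k<r. v i x * (c i j k * G j k))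
            + 2 * (\<Sum>j<r. a i j * Gam L (v i) (F j) x)"
        unfolding L_smooth_mult(2)[OF F v[OF i] \<psi>i[OF i]] using crit i
        by (simp add: a_def c_def G_def distrib_left sum_distrib_left)
    qed simp
    finally show ?thesis by (simp add: sum.distrib sum_distrib_left)
  qed
  have GfLg: "Gam L f (L g) x = (\<Sum>i<r. L (F i) x * (\<Sum>j<r. a i j * v j x)) +
      (\<Sum>i<r. \<Sum>j<r. a i j * Gam L f (Gam L (F i) (F j)) x) + (\<Sum>i<r. \<Sum>j<r. \<Sum>k<r. G i j * (c i j k * v k x))"
  proof -
    define P where "P i = (\<lambda>y. partial_der i \<psi> (\<lambda>k. F k y) * L (F i) y)" for i
    define Q where "Q i j = (\<lambda>y. partial_der j (partial_der i \<psi>) (\<lambda>k. F k y) * Gam L (F i) (F j) y)" for i j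
    have P: "P i \<in> A" if "i < r" for i
      unfolding P_def using L_smooth_mult(1)[OF F L_mem[OF F'] \<psi>i] that by blast
    have Q: "Q i j \<in> A" if "i < r" "j < r" for i j
      unfolding Q_def using L_smooth_mult(1)[OF F Gam_mem[OF F' F'] \<psi>ij] that by blast
    have QQ: "(\<lambda>y. \<Sum>j<r. Q i j y) \<in> A" if "i < r" for i
      by (rule sum_mem) (use that Q in auto)
    have "L g = (\<lambda>y. \<Sum>i<r. P i y) + (\<lambda>y. \<Sum>i<r. \<Sum>j<r. Q i j y)"
      unfolding g_def P_def Q_def by (rule ext) (simp add: chain_rule[OF F \<psi>])
    then have "Gam L f (L g) x = Gam L f (\<lambda>y. \<Sum>i<r. P i y) x + Gam L f (\<lambda>y. \<Sum>i<r. \<Sum>j<r. Q i j y) x"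
      using Gam_add_right[OF sum_mem[of "{..<r}" P] sum_mem[of "{..<r}" "\<lambda>i y. \<Sum>j<r. Q i j y"] f] P QQ
      by simp
    also have "Gam L f (\<lambda>y. \<Sum>i<r. P i y) x = (\<Sum>i<r. Gam L f (P i) x)"
      by (rule linear_on_sum[OF linear_on_Gam_right[OF f]]) (auto simp: P)
    also have "\<dots> = (\<Sum>i<r. L (F i) x * (\<Sum>j<r. a i j * v j x))"
    proof (rule sum.cong)
      fix i assume "i \<in> {..<r}"
      then have i: "i < r" by simp
      show "Gam L f (P i) x = L (F i) x * (\<Sum>j<r. a i j * v j x)"
        unfolding P_def Gam_smooth_mult[OF F f L_mem[OF F'[OF i]] \<psi>i[OF i]]
        using crit i by (simp add: a_def v_def)
    qed simp
    also have "Gam L f (\<lambda>y. \<Sum>i<r. \<Sum>j<r. Q i j y) x = (\<Sum>i<r. Gam L f (\<lambda>y. \<Sum>j<r. Q i j y) x)"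
      by (rule linear_on_sum[OF linear_on_Gam_right[OF f]]) (auto simp: QQ)
    also have "\<dots> = (\<Sum>i<r. \<Sum>j<r. Gam L f (Q i j) x)"
      by (intro sum.cong linear_on_sum[OF linear_on_Gam_right[OF f]] refl) (auto simp: Q)
    also have "\<dots> = (\<Sum>i<r. \<Sum>j<r. a i j * Gam L f (Gam L (F i) (F j)) x + (\<Sum>k<r. G i j * (c i j k * v k x)))"
    proof (intro sum.cong refl)
      fix i j assume "i \<in> {..<r}" "j \<in> {..<r}"
      then have i: "i < r" and j: "j < r" by simp_all
      show "Gam L f (Q i j) x = a i j * Gam L f (Gam L (F i) (F j)) x + (\<Sum>k<r. G i j * (c i j k * v k x))"
        unfolding Q_def Gam_smooth_mult[OF F f Gam_mem[OF F'[OF i] F'[OF j]] \<psi>ij[OF i j]]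
        by (simp add: a_def v_def c_def G_def sum_distrib_left)
    qed
    finally show ?thesis by (simp add: sum.distrib)
  qed
  have GgLf: "Gam L g (L f) x = 0"
    unfolding Gam_commute[of g] unfolding g_def Gam_smooth[OF F L_mem[OF f] \<psi>] using crit by simp
  have first: "(\<Sum>i<r. v i x * (\<Sum>j<r. a i j * L (F j) x)) = (\<Sum>i<r. L (F i) x * (\<Sum>j<r. a i j * v j x))"
    unfolding sum_distrib_left by (subst sum.swap) (intro sum.cong, auto simp: a_sym)
  \<comment> \<open>Cyclic renaming of the indices, and symmetry of the third derivatives.\<close>
  have third: "(\<Sum>i<r. \<Sum>j<r. \<Sum>k<r. v i x * (c i j k * G j k)) = (\<Sum>i<r. \<Sum>j<r. \<Sum>k<r. G i j * (c i j k * v k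
      x))"
    unfolding sum_rotate3[where S="{..<r}" and T="\<lambda>i j k. G i j * (c i j k * v k x)"]
    by (intro sum.cong) (auto simp: c_rot)
  have swap: "(\<Sum>i<r. \<Sum>j<r. a i j * Gam L (F i) (v j) x) = (\<Sum>i<r. \<Sum>j<r. a i j * Gam L (v i) (F j) x)"
    by (subst sum.swap) (intro sum.cong, auto simp: a_sym Gam_commute[of "v _"])
  have hess: "2 * (\<Sum>i<r. \<Sum>j<r. a i j * Hess L f (F i) (F j) x) =
     2 * (\<Sum>i<r. \<Sum>j<r. a i j * Gam L (v i) (F j) x) - (\<Sum>i<r. \<Sum>j<r. a i j * Gam L f (Gam L (F i) (F j)) x)"
  proof -
    have "2 * (a i j * Hess L f (F i) (F j) x) = a i j * Gam L (F i) (v j) x + a i j * Gam L (v i) (F j) x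
       - a i j * Gam L f (Gam L (F i) (F j)) x" for i j
      by (simp add: Hess_def v_def Gam_commute[of "Gam L f (F i)"] field_simps)
    then have "2 * (\<Sum>i<r. \<Sum>j<r. a i j * Hess L f (F i) (F j) x) =
      (\<Sum>i<r. \<Sum>j<r. a i j * Gam L (F i) (v j) x) + (\<Sum>i<r. \<Sum>j<r. a i j * Gam L (v i) (F j) x)
        - (\<Sum>i<r. \<Sum>j<r. a i j * Gam L f (Gam L (F i) (F j)) x)"
      by (simp only: sum_distrib_left sum.distrib sum_subtractf)
    then show ?thesis by (simp add: swap)
  qed
  have "2 * Gam2 L f g x = 2 * (\<Sum>i<r. \<Sum>j<r. a i j * Hess L f (F i) (F j) x)"
    unfolding hess using Lfg GfLg GgLf first third by (simp add: Gam2_def)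
  then show ?thesis by (simp add: g_def a_def)
qed

text \<open>
  The computation on which everything rests: adding to \<open>f\<close> a function \<open>g = \<psi>(F)\<close> of an orthonormal
  system whose differential vanishes at \<open>x\<close> does not change \<open>f\<close> to first order, but changes
  \<open>\<Gamma>\<^sub>2(f)(x)\<close> by a quadratic polynomial in the second derivatives \<open>a\<^sub>i\<^sub>j\<close> of \<open>\<psi>\<close>, with linear part given by
  the Hessian of \<open>f\<close>, and \<open>L f(x)\<close> by the trace of \<open>a\<close>. The quadratic part arises because the Hessian
  of \<open>g\<close> itself is \<open>a\<close>.
\<close>
lemma second_order_perturbation:
  assumes ortho: "orthonormal_at A L x {..<r} F" and f: "f \<in> A"
    and \<psi>: "smooth_in {..<r} \<psi>" "\<psi> (\<lambda>_. 0) = 0"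
    and crit: "\<forall>i<r. partial_der i \<psi> (\<lambda>k. F k x) = 0"
    and a: "\<And>i j. i < r \<Longrightarrow> j < r \<Longrightarrow> a i j = partial_der j (partial_der i \<psi>) (\<lambda>k. F k x)"
  defines "g \<equiv> \<lambda>y. \<psi> (\<lambda>i. F i y)"
  shows "g \<in> A" "Gam L g g x = 0" "L g x = (\<Sum>i<r. a i i)"
    "Gam2 L (f + g) (f + g) x =
      Gam2 L f f x + (\<Sum>i<r. \<Sum>j<r. 2 * a i j * Hess L f (F i) (F j) x + (a i j)\<^sup>2)"
proof -
  have F: "\<forall>i<r. F i \<in> A" using ortho by (simp add: orthonormal_at_def)
  have \<delta>: "Gam L (F i) (F j) x = (if i = j then 1 else 0)" if "i < r" "j < r" for i j
    using ortho that by (simp add: orthonormal_at_def)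
  show g: "g \<in> A" unfolding g_def by (rule comp_mem[OF F \<psi>])
  have null: "Gam L h g x = 0" if "h \<in> A" for h
    unfolding g_def Gam_smooth[OF F that \<psi>] using crit by simp
  show "Gam L g g x = 0" by (rule null[OF g])
  have "L g x = (\<Sum>i<r. \<Sum>j<r. a i j * (if i = j then 1 else 0))"
  proof -
    have "(\<Sum>i<r. partial_der i \<psi> (\<lambda>k. F k x) * L (F i) x) = 0" using crit by simp
    moreover have "(\<Sum>i<r. \<Sum>j<r. partial_der j (partial_der i \<psi>) (\<lambda>k. F k x) * Gam L (F i) (F j) x) =
        (\<Sum>i<r. \<Sum>j<r. a i j * (if i = j then 1 else 0))"
      by (intro sum.cong refl) (auto simp: \<delta> a)
    ultimately show ?thesis unfolding g_def chain_rule[OF F \<psi>] by simp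
  qed
  also have "\<dots> = (\<Sum>i<r. \<Sum>j<r. if i = j then a i j else 0)"
    by (intro sum.cong) auto
  also have "\<dots> = (\<Sum>i<r. a i i)"
    by (intro sum.cong) auto
  finally show "L g x = (\<Sum>i<r. a i i)" .
  have \<psi>i: "smooth_in {..<r} (partial_der i \<psi>)" if "i < r" for i
    using smooth_in_partial_der[OF \<psi>(1)] that by simp
  have GFg: "Gam L (F i) (Gam L g (F j)) x = a i j" if i: "i < r" and j: "j < r" for i j
  proof -
    have Fij: "F i \<in> A" "F j \<in> A" using F i j by auto
    have "Gam L (F j) g = (\<lambda>y. \<Sum>k<r. partial_der k \<psi> (\<lambda>k. F k y) * Gam L (F j) (F k) y)"
      unfolding g_def by (intro ext Gam_smooth F Fij \<psi>)
    then have "Gam L g (F j) = (\<lambda>y. \<Sum>k<r. partial_der k \<psi> (\<lambda>k. F k y) * Gam L (F j) (F k) y)"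
      by (simp add: Gam_commute[of g])
    then have "Gam L (F i) (Gam L g (F j)) x =
        (\<Sum>k<r. Gam L (F i) (\<lambda>y. partial_der k \<psi> (\<lambda>k. F k y) * Gam L (F j) (F k) y) x)"
      using linear_on_sum[OF linear_on_Gam_right[OF Fij(1)], of "{..<r}"
          "\<lambda>k y. partial_der k \<psi> (\<lambda>k. F k y) * Gam L (F j) (F k) y" x]
        L_smooth_mult(1)[OF F _ \<psi>i] F Fij by (simp add: Gam_mem)
    also have "\<dots> = (\<Sum>k<r. if j = k then a k i else 0)"
    proof (rule sum.cong)
      fix k assume "k \<in> {..<r}"
      then have k: "k < r" by simp
      have "(\<Sum>l<r. partial_der l (partial_der k \<psi>) (\<lambda>k. F k x) * Gam L (F i) (F l) x) =
          (\<Sum>l<r. if i = l then a k l else 0)"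
        by (intro sum.cong) (use k i in \<open>auto simp: \<delta> a\<close>)
      also have "\<dots> = a k i" using i by simp
      finally have "Gam L (F i) (\<lambda>y. partial_der k \<psi> (\<lambda>k. F k y) * Gam L (F j) (F k) y) x =
          (if j = k then 1 else 0) * a k i"
        unfolding Gam_smooth_mult[OF F Fij(1) Gam_mem[OF Fij(2) F[rule_format, OF k]] \<psi>i[OF k]]
        using crit k j by (simp add: \<delta>)
      then show "Gam L (F i) (\<lambda>y. partial_der k \<psi> (\<lambda>k. F k y) * Gam L (F j) (F k) y) x =
          (if j = k then a k i else 0)"
        by simp
    qed simp
    also have "\<dots> = a j i" using j by simp
    also have "\<dots> = a i j"
      using i j partial_der_commute[OF \<psi>(1), of i j] by (simp add: a)
    finally show ?thesis .
  qed
  have Hg: "Hess L g (F i) (F j) x = a i j" if "i < r" "j < r" for i j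
  proof -
    have "Gam L g (Gam L (F i) (F j)) x = 0"
      using null[OF Gam_mem] F that by (simp add: Gam_commute[of g])
    moreover have "a j i = a i j" using that partial_der_commute[OF \<psi>(1), of i j] by (simp add: a)
    ultimately show ?thesis using that by (simp add: Hess_def GFg)
  qed
  have fg: "Gam2 L h g x = (\<Sum>i<r. \<Sum>j<r. a i j * Hess L h (F i) (F j) x)" if "h \<in> A" for h
    unfolding g_def Gam2_smooth[OF F that \<psi> crit] by (intro sum.cong refl) (auto simp: a)
  have "Gam2 L g g x = (\<Sum>i<r. \<Sum>j<r. (a i j)\<^sup>2)"
    unfolding fg[OF g] by (intro sum.cong) (auto simp: Hg power2_eq_square)
  then show "Gam2 L (f + g) (f + g) x =
      Gam2 L f f x + (\<Sum>i<r. \<Sum>j<r. 2 * a i j * Hess L f (F i) (F j) x + (a i j)\<^sup>2)"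
    unfolding Gam2_add[OF f g] fg[OF f] by (simp add: sum.distrib sum_distrib_left mult.assoc)
qed

section \<open>The extension to constants\<close>

text \<open>
  The quadratic relation \<open>L(c\<^sup>2) = 2 c L(c) + 2 \<Gamma>(c, c)\<close> is merely the definition of \<open>\<Gamma>\<close>; the chain rule for
  the cube is the first one that carries information.
\<close>
lemma L_const:
  assumes "(\<lambda>_. c) \<in> A" shows "L (\<lambda>_. c) = (\<lambda>_. 0)"
proof (cases "c = 0")
  case True
  have "L (\<lambda>y. 0 * 0 y) = (\<lambda>y. 0 * L 0 y)" using L_scale[OF zero_mem, of 0] .
  then show ?thesis using True by simp
next
  case False
  show ?thesis
  proof
    fix x
    define \<psi> where "\<psi> = (\<lambda>y::nat \<Rightarrow> real. y 0 * (y 0 * y 0))"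
    have alg: "(\<lambda>y::nat \<Rightarrow> real. y 0) \<in> smooth_algebra {..<1}" "(\<lambda>y::nat \<Rightarrow> real. y 0 * y 0) \<in>
        smooth_algebra {..<1}"
      by (intro smooth_algebra.intros; simp)+
    have "\<psi> \<in> smooth_algebra {..<1}" unfolding \<psi>_def by (intro smooth_algebra.mult alg)
    then have \<psi>: "smooth_in {..<1} \<psi>" by (rule smooth_algebra_imp_smooth_in)
    have D1: "partial_der 0 \<psi> = (\<lambda>y. 3 * (y 0)\<^sup>2)"
      unfolding \<psi>_def
      by (intro ext partial_der_eqI) (auto intro!: derivative_eq_intros simp: power2_eq_square)
    have D2: "partial_der 0 (partial_der 0 \<psi>) = (\<lambda>y. 6 * y 0)"
      unfolding D1 by (intro ext partial_der_eqI) (auto intro!: derivative_eq_intros)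
    have "L (\<lambda>_. c * (c * c)) x = 3 * c\<^sup>2 * L (\<lambda>_. c) x + 6 * c * Gam L (\<lambda>_. c) (\<lambda>_. c) x"
      using chain_rule[of 1 "\<lambda>_ _. c" \<psi> x] assms \<psi> by (simp add: D1 D2[unfolded D1]) (simp add: \<psi>_def)
    moreover have "L (\<lambda>_. (c * c) * c) x = c\<^sup>2 * L (\<lambda>_. c) x"
      using L_scale[OF assms, of "c * c"] by (simp add: power2_eq_square)
    moreover have "Gam L (\<lambda>_. c) (\<lambda>_. c) x = - (c * L (\<lambda>_. c) x) / 2"
      using L_scale[OF assms, of c] by (simp add: Gam_def times_fun_def)
    ultimately show "L (\<lambda>_. c) x = 0" using False by (simp add: power2_eq_square mult.assoc)
  qed
qed

lemma ext_add_const: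
  assumes "h \<in> A" shows "ext A L (h + (\<lambda>_. c)) = L h"
proof -
  define f where "f = (SOME f. f \<in> A \<and> (\<exists>d. h + (\<lambda>_. c) = f + (\<lambda>_. d)))"
  have "f \<in> A \<and> (\<exists>d. h + (\<lambda>_. c) = f + (\<lambda>_. d))"
    unfolding f_def by (rule someI[of _ h]) (use assms in auto)
  then obtain d where f: "f \<in> A" and d: "h + (\<lambda>_. c) = f + (\<lambda>_. d)" by blast
  have fh: "f = h + (\<lambda>_. c - d)" using d by (auto simp: fun_eq_iff algebra_simps)
  have "(\<lambda>_. c - d) = f - h" by (auto simp: fh)
  then have "(\<lambda>_. c - d) \<in> A" using diff_mem[OF f assms] by simp
  then have "L f = L h" using L_add[OF assms] L_const by (auto simp: fh)
  then show ?thesis by (simp add: ext_def f_def)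
qed

lemma ext_eq: "h \<in> A \<Longrightarrow> ext A L h = L h"
  using ext_add_const[of h 0] by (simp add: plus_fun_def)

lemma Gam_ext_add_const:
  assumes "h \<in> A" "k \<in> A"
  shows "Gam (ext A L) (h + (\<lambda>_. c)) (k + (\<lambda>_. d)) = Gam L h k"
proof
  fix x
  have "(h + (\<lambda>_. c)) * (k + (\<lambda>_. d)) = (h * k + ((\<lambda>y. c * k y) + (\<lambda>y. d * h y))) + (\<lambda>_. c * d)"
    by (auto simp: algebra_simps)
  then have "ext A L ((h + (\<lambda>_. c)) * (k + (\<lambda>_. d))) = L (h * k + ((\<lambda>y. c * k y) + (\<lambda>y. d * h y)))"
    using ext_add_const assms by (simp add: add_mem mult_mem scale_mem)
  moreover have "L (h * k + ((\<lambda>y. c * k y) + (\<lambda>y. d * h y))) x = L (h * k) x + c * L k x + d * L h x"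
    using assms by (simp add: L_add L_scale add_mem mult_mem scale_mem)
  ultimately show "Gam (ext A L) (h + (\<lambda>_. c)) (k + (\<lambda>_. d)) x = Gam L h k x"
    unfolding Gam_def ext_add_const[OF assms(1)] ext_add_const[OF assms(2)] by (simp add: field_simps)
qed

lemma Gam2_ext_add_const:
  assumes "h \<in> A" shows "Gam2 (ext A L) (h + (\<lambda>_. c)) (h + (\<lambda>_. c)) x = Gam2 L h h x"
proof -
  have "Gam (ext A L) (h + (\<lambda>_. c)) (L h) = Gam L h (L h)"
    using Gam_ext_add_const[OF assms L_mem[OF assms], of c 0] by (simp add: plus_fun_def)
  then show ?thesis
    unfolding Gam2_def Gam_ext_add_const[OF assms assms] ext_add_const[OF assms]
    using assms by (simp add: ext_eq Gam_mem)
qed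

end

section \<open>Orthonormal systems and bilinear forms at a point\<close>

text \<open>
  Gaussian elimination: solve the last equation for one unknown \<open>k\<close> and substitute.
\<close>
lemma homogeneous_system_nontrivial_solution:
  fixes M :: "nat \<Rightarrow> 'j \<Rightarrow> real"
  assumes "finite J" "m < card J"
  shows "\<exists>c. (\<exists>j\<in>J. c j \<noteq> 0) \<and> (\<forall>i<m. (\<Sum>j\<in>J. M i j * c j) = 0)"
  using assms
proof (induction m arbitrary: J M)
  case 0
  then obtain j where "j \<in> J" by (metis card.empty ex_in_conv less_irrefl)
  then show ?case by (intro exI[of _ "\<lambda>_. 1"]) auto
next
  case (Suc m)
  show ?case
  proof (cases "\<forall>j\<in>J. M m j = 0")
    case True
    obtain c where "\<exists>j\<in>J. c j \<noteq> 0" "\<forall>i<m. (\<Sum>j\<in>J. M i j * c j) = 0"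
      using Suc.IH[of J M] Suc.prems by auto
    then show ?thesis using True by (intro exI[of _ c]) (auto simp: less_Suc_eq)
  next
    case False
    then obtain k where k: "k \<in> J" "M m k \<noteq> 0" by blast
    define J' where "J' = J - {k}"
    have J': "finite J'" "m < card J'" "k \<notin> J'" and J: "J = insert k J'"
      using Suc.prems k by (auto simp: J'_def card_Diff_singleton)
    obtain c where c: "\<exists>j\<in>J'. c j \<noteq> 0"
      and sol: "\<forall>i<m. (\<Sum>j\<in>J'. (M i j - M i k / M m k * M m j) * c j) = 0"
      using Suc.IH[OF J'(1,2), of "\<lambda>i j. M i j - M i k / M m k * M m j"] by blast
    \<comment> \<open>The value of the unknown that was eliminated.\<close>
    define d where "d j = (if j = k then - (\<Sum>j\<in>J'. M m j * c j) / M m k else c j)" for j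
    have dJ': "(\<Sum>j\<in>J'. M i j * d j) = (\<Sum>j\<in>J'. M i j * c j)" for i
      by (intro sum.cong) (use J'(3) in \<open>auto simp: d_def\<close>)
    have "(\<Sum>j\<in>J. M i j * d j) = 0" if "i < Suc m" for i
    proof (cases "i = m")
      case True
      then show ?thesis using J' k(2) unfolding J by (simp add: dJ') (simp add: d_def)
    next
      case False
      then have "(\<Sum>j\<in>J'. (M i j - M i k / M m k * M m j) * c j) = 0" using sol that by auto
      then have "(\<Sum>j\<in>J'. M i j * c j) - M i k / M m k * (\<Sum>j\<in>J'. M m j * c j) = 0"
        by (simp add: left_diff_distrib sum_subtractf sum_distrib_left mult.assoc)
      then show ?thesis using J' k(2) unfolding J by (simp add: dJ') (simp add: d_def)
    qed
    moreover have "\<exists>j\<in>J. d j \<noteq> 0" using c J'(3) unfolding J d_def by auto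
    ultimately show ?thesis by blast
  qed
qed

text \<open>
  Used below to show that a quadratic expression which stays bounded along a line of
  representatives of one class is constant along it.
\<close>
lemma bounded_quadratic_trivial:
  fixes \<alpha> \<beta> \<gamma> C :: real
  assumes "\<And>t. \<bar>\<alpha> + \<beta> * t + \<gamma> * t\<^sup>2\<bar> \<le> C"
  shows "\<beta> = 0 \<and> \<gamma> = 0"
proof -
  have C: "C \<ge> 0" using assms[of 0] by simp
  have \<beta>: "\<bar>\<beta>\<bar> * t \<le> C" if "t \<ge> 0" for t
  proof -
    have "\<bar>\<beta> * t\<bar> \<le> C" using assms[of t] assms[of "- t"] by (simp add: abs_le_iff)
    then show ?thesis using that by (simp add: abs_mult)
  qed
  have "\<beta> = 0"
  proof (rule ccontr)
    assume "\<beta> \<noteq> 0"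
    then show False using \<beta>[of "(C + 1) / \<bar>\<beta>\<bar>"] C by simp
  qed
  moreover have "\<gamma> = 0"
  proof (rule ccontr)
    assume \<gamma>: "\<gamma> \<noteq> 0"
    have "\<bar>\<gamma> * t\<^sup>2\<bar> \<le> 2 * C" for t using assms[of t] assms[of 0] \<open>\<beta> = 0\<close> by (simp add: abs_le_iff)
    from this[of "sqrt ((2 * C + 1) / \<bar>\<gamma>\<bar>)"] show False using C \<gamma> by (simp add: abs_mult)
  qed
  ultimately show ?thesis by simp
qed

lemma orthonormal_at_subset: "orthonormal_at A L x J b \<Longrightarrow> K \<subseteq> J \<Longrightarrow> orthonormal_at A L x K b"
  unfolding orthonormal_at_def by blast

lemma indep_mod_le_dim: "indep_mod A L x r F \<Longrightarrow> enat r \<le> dim_at A L x"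
  unfolding dim_at_def by (rule SUP_upper) auto

text \<open>
  An independent family of exactly \<open>r\<close> functions could be had by truncation, but a longer one serves
  as well.
\<close>
lemma exists_indep_mod:
  assumes "enat r \<le> dim_at A L x"
  shows "\<exists>k F. r \<le> k \<and> indep_mod A L x k F"
proof (cases r)
  case 0
  have "indep_mod A L x 0 F" for F by (simp add: indep_mod_def)
  then show ?thesis using 0 by blast
next
  case (Suc s)
  then have "enat s < dim_at A L x" using assms by (metis enat_ord_simps(2) lessI less_le_trans)
  then obtain k where "k \<in> {r. \<exists>F. indep_mod A L x r F}" "enat s < enat k"
    unfolding dim_at_def less_SUP_iff by blast
  then show ?thesis using Suc by (auto simp: Suc_le_eq)
qed

text \<open>
  The symmetric bilinear forms on the inner product space \<open>A\<^sup>1\<^sub>x\<close>, evaluated on representatives.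
\<close>
definition quotient_form ::
  "('a \<Rightarrow> real) set \<Rightarrow> (('a \<Rightarrow> real) \<Rightarrow> 'a \<Rightarrow> real) \<Rightarrow> 'a \<Rightarrow>
     (('a \<Rightarrow> real) \<Rightarrow> ('a \<Rightarrow> real) \<Rightarrow> real) \<Rightarrow> bool" where
  "quotient_form A L x B \<longleftrightarrow>
     (\<forall>h\<in>A. linear_on A (\<lambda>g. B g h)) \<and> (\<forall>g\<in>A. \<forall>h\<in>A. B g h = B h g) \<and>
     (\<forall>g\<in>A. \<forall>h\<in>A. Gam L g g x = 0 \<longrightarrow> B g h = 0)"

lemma quotient_formD:
  assumes "quotient_form A L x B" "h \<in> A"
  shows "linear_on A (\<lambda>g. B g h)" "g \<in> A \<Longrightarrow> B g h = B h g"
    "g \<in> A \<Longrightarrow> Gam L g g x = 0 \<Longrightarrow> B g h = 0"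
  using assms unfolding quotient_form_def by blast+

lemma quotient_form_diff:
  assumes "quotient_form A L x B" "quotient_form A L x B'"
  shows "quotient_form A L x (\<lambda>g h. B g h - c * B' g h)"
  unfolding quotient_form_def
proof (intro conjI ballI impI)
  fix h assume h: "h \<in> A"
  show "linear_on A (\<lambda>g. B g h - c * B' g h)"
    using quotient_formD(1)[OF assms(1) h] quotient_formD(1)[OF assms(2) h]
    unfolding linear_on_def by (simp add: algebra_simps)
  fix g assume g: "g \<in> A"
  show "B h g - c * B' h g = B g h - c * B' g h"
    by (simp only: quotient_formD(2)[OF assms(1) h g] quotient_formD(2)[OF assms(2) h g])
next
  fix g h assume "g \<in> A" "h \<in> A" "Gam L g g x = 0"
  then show "B g h - c * B' g h = 0"
    using quotient_formD(3)[OF assms(1)] quotient_formD(3)[OF assms(2)] by simp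
qed

context diffusion_operator
begin

text \<open>
  The Cauchy-Schwarz inequality in the degenerate case: otherwise \<open>\<Gamma>(t g + h)(x)\<close> would be a
  nonconstant affine function of \<open>t\<close>. The value chosen for \<open>t\<close> makes it \<open>- 1\<close>.
\<close>
lemma Gam_null:
  assumes g: "g \<in> A" "Gam L g g x = 0" and h: "h \<in> A"
  shows "Gam L g h x = 0"
proof (rule ccontr)
  assume ne: "Gam L g h x \<noteq> 0"
  \<comment> \<open>The solution of \<open>2 t \<Gamma>(g, h)(x) + \<Gamma>(h)(x) = - 1\<close>.\<close>
  define t where "t = - (Gam L h h x + 1) / (2 * Gam L g h x)"
  have tg: "(\<lambda>y. t * g y) \<in> A" using g by (simp add: scale_mem)
  have "0 \<le> Gam L ((\<lambda>y. t * g y) + h) ((\<lambda>y. t * g y) + h) x"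
    by (intro Gam_nonneg add_mem tg h)
  also have "\<dots> = 2 * (t * Gam L g h x) + Gam L h h x"
    using g tg h by (simp add: Gam_self_add Gam_scale_left Gam_scale_right)
  also have "\<dots> = - 1" using ne by (simp add: t_def field_simps)
  finally show False by simp
qed

lemma quotient_form_Gam: "quotient_form A L x (\<lambda>g h. Gam L g h x)"
  unfolding quotient_form_def
proof (intro conjI ballI impI)
  show "Gam L g h x = Gam L h g x" for g h by (simp only: Gam_commute[of g h])
qed (simp_all add: linear_on_Gam_left Gam_null)

lemma orthonormal_extend:
  assumes b: "orthonormal_at A L x {..<m} b" and s: "s \<in> A" "Gam L s s x \<noteq> 0"
    and orth: "\<forall>i<m. Gam L s (b i) x = 0"
  shows "\<exists>u. orthonormal_at A L x {..<Suc m} (b(m := u))"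
proof -
  define k where "k = 1 / sqrt (Gam L s s x)"
  define u where "u = (\<lambda>y. k * s y)"
  have pos: "Gam L s s x > 0" using Gam_nonneg[OF s(1), of x] s(2) by simp
  have u: "u \<in> A" using s by (simp add: u_def scale_mem)
  have uh: "Gam L u h x = k * Gam L s h x" if "h \<in> A" for h
    unfolding u_def using s that by (simp add: Gam_scale_left)
  have "Gam L u u x = k * (k * Gam L s s x)"
    using uh[OF u] uh[OF s(1)] Gam_commute[of s u] by simp
  then have uu: "Gam L u u x = 1" using pos by (simp add: k_def)
  have bA: "b i \<in> A" if "i < m" for i using b that by (simp add: orthonormal_at_def)
  have "Gam L u (b i) x = 0" "Gam L (b i) u x = 0" if "i < m" for i
    using uh[OF bA[OF that]] orth that Gam_commute[of u "b i"] by auto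
  then show ?thesis
    using b u uu by (intro exI[of _ u]) (auto simp: orthonormal_at_def less_Suc_eq)
qed

text \<open>
  In the span of more than \<open>m\<close> independent functions some nonzero element is orthogonal to the \<open>m\<close>
  given ones, being the solution of \<open>m\<close> linear equations; it only has to be normalised.
\<close>
lemma orthonormal_extend_one:
  assumes b: "orthonormal_at A L x {..<m} b" and F: "indep_mod A L x r F" and "m < r"
  shows "\<exists>u. orthonormal_at A L x {..<Suc m} (b(m := u))"
proof -
  have FA: "F j \<in> A" if "j < r" for j using F that by (simp add: indep_mod_def)
  obtain c where c: "\<exists>j\<in>{..<r}. c j \<noteq> 0"
    and sol: "\<forall>i<m. (\<Sum>j<r. Gam L (F j) (b i) x * c j) = 0"
    using homogeneous_system_nontrivial_solution[of "{..<r}" m "\<lambda>i j. Gam L (F j) (b i) x"] assms(3) by auto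
  define s where "s = (\<lambda>y. \<Sum>j<r. c j * F j y)"
  have s: "s \<in> A" unfolding s_def by (rule sum_mem) (auto intro: scale_mem FA)
  have "Gam L s (b i) x = 0" if "i < m" for i
  proof -
    have "b i \<in> A" using b that by (simp add: orthonormal_at_def)
    then have "Gam L s (b i) x = (\<Sum>j<r. c j * Gam L (F j) (b i) x)"
      unfolding s_def by (intro linear_on_sum_scaled linear_on_Gam_left) (auto intro: FA)
    then show ?thesis using sol that by (simp add: mult.commute)
  qed
  moreover have "Gam L s s x \<noteq> 0"
    using F c unfolding indep_mod_def Let_def s_def by blast
  ultimately show ?thesis using orthonormal_extend[OF b s] by blast
qed

lemma orthonormal_extend_to:
  assumes b: "orthonormal_at A L x {..<m} b" and "enat r \<le> dim_at A L x" and "m \<le> r"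
  shows "\<exists>b'. orthonormal_at A L x {..<r} b' \<and> (\<forall>i<m. b' i = b i)"
  using assms(3,2)
proof (induction r rule: dec_induct)
  case base
  show ?case using b by blast
next
  case (step r)
  have "enat r \<le> enat (Suc r)" by simp
  also have "\<dots> \<le> dim_at A L x" by (rule step.prems)
  finally have "enat r \<le> dim_at A L x" .
  then obtain b' where b': "orthonormal_at A L x {..<r} b'" "\<forall>i<m. b' i = b i" using step.IH by blast
  obtain k F where "Suc r \<le> k" "indep_mod A L x k F" using exists_indep_mod[OF step.prems] by blast
  then obtain u where "orthonormal_at A L x {..<Suc r} (b'(r := u))"
    using orthonormal_extend_one[OF b'(1)] by (meson Suc_le_lessD)
  moreover have "\<forall>i<m. (b'(r := u)) i = b i" using b'(2) step.hyps(1) by auto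
  ultimately show ?case by blast
qed

lemma exists_orthonormal:
  assumes "enat r \<le> dim_at A L x" shows "\<exists>b. orthonormal_at A L x {..<r} b"
  using orthonormal_extend_to[of x 0 undefined r] assms by (auto simp: orthonormal_at_def)

lemma orthonormal_le_dim:
  assumes b: "orthonormal_at A L x {..<r} b" shows "enat r \<le> dim_at A L x"
proof -
  have bA: "b i \<in> A" if "i < r" for i using b that by (simp add: orthonormal_at_def)
  have "c i = 0" if s0: "Gam L s s x = 0" and s: "s = (\<lambda>y. \<Sum>i<r. c i * b i y)" and i: "i < r" for c s i
  proof -
    have sA: "s \<in> A" unfolding s by (rule sum_mem) (auto intro: scale_mem bA)
    have "0 = Gam L s (b i) x" using Gam_null[OF sA s0 bA[OF i]] by simp
    also have "\<dots> = (\<Sum>j<r. c j * Gam L (b j) (b i) x)"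
      unfolding s by (intro linear_on_sum_scaled linear_on_Gam_left bA i) (auto intro: bA)
    also have "\<dots> = (\<Sum>j<r. if j = i then c j else 0)"
      by (intro sum.cong) (use b i in \<open>auto simp: orthonormal_at_def\<close>)
    also have "\<dots> = c i" using i by simp
    finally show ?thesis by simp
  qed
  then have "indep_mod A L x r b" unfolding indep_mod_def Let_def using bA by blast
  then show ?thesis by (rule indep_mod_le_dim)
qed

text \<open>
  An orthonormal system of full size is a basis modulo null functions: the difference \<open>s\<close> of \<open>g\<close> and its
  orthogonal projection is orthogonal to the system, hence null, as otherwise the system could be
  enlarged.
\<close>
lemma quotient_form_expand_left:
  assumes b: "orthonormal_at A L x {..<n} b" and dim: "dim_at A L x = enat n"
    and B: "quotient_form A L x B" and g: "g \<in> A" and h: "h \<in> A"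
  shows "B g h = (\<Sum>i<n. Gam L g (b i) x * B (b i) h)"
proof -
  have bA: "b i \<in> A" if "i < n" for i using b that by (simp add: orthonormal_at_def)
  define p where "p = (\<lambda>y. \<Sum>i<n. Gam L g (b i) x * b i y)"
  define s where "s = g + (\<lambda>y. - 1 * p y)"
  have p: "p \<in> A" unfolding p_def by (rule sum_mem) (auto intro: scale_mem bA)
  have mp: "(\<lambda>y. - 1 * p y) \<in> A" by (rule scale_mem[OF p])
  have s: "s \<in> A" unfolding s_def by (rule add_mem[OF g mp])
  have T: "T s = T g - (\<Sum>i<n. Gam L g (b i) x * T (b i))" if "linear_on A T" for T
  proof -
    have "T s = T g + T (\<lambda>y. - 1 * p y)" unfolding s_def using that g mp unfolding linear_on_def by blast
    also have "T (\<lambda>y. - 1 * p y) = - 1 * T p" using that p unfolding linear_on_def by blast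
    also have "T p = (\<Sum>i<n. Gam L g (b i) x * T (b i))"
      unfolding p_def by (rule linear_on_sum_scaled[OF that]) (auto intro: bA)
    finally show ?thesis by simp
  qed
  have orth: "Gam L s (b i) x = 0" if i: "i < n" for i
  proof -
    have "(\<Sum>j<n. Gam L g (b j) x * Gam L (b j) (b i) x) = (\<Sum>j<n. if j = i then Gam L g (b j) x else 0)"
      by (intro sum.cong) (use b i in \<open>auto simp: orthonormal_at_def\<close>)
    then show ?thesis using T[OF linear_on_Gam_left[OF bA[OF i]], of x] i by simp
  qed
  have "Gam L s s x = 0"
  proof (rule ccontr)
    assume "Gam L s s x \<noteq> 0"
    then obtain u where "orthonormal_at A L x {..<Suc n} (b(n := u))"
      using orthonormal_extend[OF b s] orth by blast
    then have "enat (Suc n) \<le> dim_at A L x" by (rule orthonormal_le_dim)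
    then show False using dim by simp
  qed
  then have "B s h = 0" using B s h unfolding quotient_form_def by blast
  then show ?thesis using T[of "\<lambda>g. B g h"] B h unfolding quotient_form_def by simp
qed

lemma quotient_form_expand:
  assumes b: "orthonormal_at A L x {..<n} b" and dim: "dim_at A L x = enat n"
    and B: "quotient_form A L x B" and g: "g \<in> A" and h: "h \<in> A"
  shows "B g h = (\<Sum>i<n. \<Sum>j<n. Gam L g (b i) x * Gam L h (b j) x * B (b i) (b j))"
proof -
  have bA: "b i \<in> A" if "i < n" for i using b that by (simp add: orthonormal_at_def)
  have "B (b i) h = (\<Sum>j<n. Gam L h (b j) x * B (b i) (b j))" if "i < n" for i
  proof -
    have "B (b i) h = B h (b i)" using B h bA[OF that] unfolding quotient_form_def by blast
    also have "\<dots> = (\<Sum>j<n. Gam L h (b j) x * B (b j) (b i))"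
      by (rule quotient_form_expand_left[OF b dim B h bA[OF that]])
    also have "\<dots> = (\<Sum>j<n. Gam L h (b j) x * B (b i) (b j))"
      by (intro sum.cong refl) (simp add: quotient_formD(2)[OF B bA[OF that] bA])
    finally show ?thesis .
  qed
  then show ?thesis
    unfolding quotient_form_expand_left[OF b dim B g h]
    by (simp add: sum_distrib_left mult.assoc)
qed

lemma trace_basis_independent:
  assumes b: "orthonormal_at A L x {..<n} b" and b': "orthonormal_at A L x {..<n} b'"
    and dim: "dim_at A L x = enat n" and B: "quotient_form A L x B"
  shows "(\<Sum>k<n. B (b' k) (b' k)) = (\<Sum>i<n. B (b i) (b i))"
proof -
  have bA: "b i \<in> A" "b' i \<in> A" if "i < n" for i using b b' that by (simp_all add: orthonormal_at_def)
  have parseval: "(\<Sum>k<n. Gam L (b' k) (b i) x * Gam L (b' k) (b j) x) = (if i = j then 1 else 0)"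
    if "i < n" "j < n" for i j
  proof -
    have "(\<Sum>k<n. Gam L (b' k) (b i) x * Gam L (b' k) (b j) x) =
        (\<Sum>k<n. Gam L (b i) (b' k) x * Gam L (b' k) (b j) x)"
      by (simp add: Gam_commute[of "b' _" "b i"])
    also have "\<dots> = Gam L (b i) (b j) x"
      using quotient_form_expand_left[OF b' dim quotient_form_Gam bA(1)[OF that(1)] bA(1)[OF that(2)]]
          by simp
    finally show ?thesis using b that by (simp add: orthonormal_at_def)
  qed
  have "(\<Sum>k<n. B (b' k) (b' k)) =
      (\<Sum>k<n. \<Sum>i<n. \<Sum>j<n. Gam L (b' k) (b i) x * Gam L (b' k) (b j) x * B (b i) (b j))"
    by (intro sum.cong quotient_form_expand[OF b dim B]) (auto intro: bA)
  also have "\<dots> = (\<Sum>i<n. \<Sum>k<n. \<Sum>j<n. Gam L (b' k) (b i) x * Gam L (b' k) (b j) x * B (b i) (b j))"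
    by (rule sum.swap)
  also have "\<dots> = (\<Sum>i<n. \<Sum>j<n. \<Sum>k<n. Gam L (b' k) (b i) x * Gam L (b' k) (b j) x * B (b i) (b j))"
    by (intro sum.cong sum.swap refl)
  also have "\<dots> = (\<Sum>i<n. \<Sum>j<n. if i = j then B (b i) (b j) else 0)"
    unfolding sum_distrib_right[symmetric] by (intro sum.cong) (auto simp: parseval)
  also have "\<dots> = (\<Sum>i<n. B (b i) (b i))" by (intro sum.cong) auto
  finally show ?thesis .
qed

text \<open>
  Expand only one factor of each square on the left in the basis \<open>b\<close>; after exchanging the sums, the
  inner sum is the expansion of \<open>B(b\<^sub>i, b\<^sub>j)\<close> in the basis \<open>b'\<close>.
\<close>
lemma HS_basis_independent:
  assumes b: "orthonormal_at A L x {..<n} b" and b': "orthonormal_at A L x {..<n} b'"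
    and dim: "dim_at A L x = enat n" and B: "quotient_form A L x B"
  shows "(\<Sum>k<n. \<Sum>l<n. (B (b' k) (b' l))\<^sup>2) = (\<Sum>i<n. \<Sum>j<n. (B (b i) (b j))\<^sup>2)"
proof -
  have bA: "b i \<in> A" "b' i \<in> A" if "i < n" for i using b b' that by (simp_all add: orthonormal_at_def)
  define T where "T k l i j = Gam L (b' k) (b i) x * Gam L (b' l) (b j) x * B (b i) (b j) * B (b' k) (b'
      l)" for k l i j
  have "(\<Sum>k<n. \<Sum>l<n. (B (b' k) (b' l))\<^sup>2) = (\<Sum>(k,l)\<in>{..<n}\<times>{..<n}. \<Sum>(i,j)\<in>{..<n}\<times>{..<n}. T k l i j)"
    unfolding sum.cartesian_product[symmetric]
  proof (intro sum.cong refl)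
    fix k l assume "k \<in> {..<n}" "l \<in> {..<n}"
    then have kl: "b' k \<in> A" "b' l \<in> A" by (simp_all add: bA)
    show "(B (b' k) (b' l))\<^sup>2 = (\<Sum>i<n. \<Sum>j<n. T k l i j)"
      unfolding T_def sum_distrib_right[symmetric] quotient_form_expand[OF b dim B kl, symmetric]
      by (rule power2_eq_square)
  qed
  also have "\<dots> = (\<Sum>(i,j)\<in>{..<n}\<times>{..<n}. \<Sum>(k,l)\<in>{..<n}\<times>{..<n}. T k l i j)"
    unfolding case_prod_unfold by (rule sum.swap)
  also have "\<dots> = (\<Sum>i<n. \<Sum>j<n. B (b i) (b j) *
      (\<Sum>k<n. \<Sum>l<n. Gam L (b i) (b' k) x * Gam L (b j) (b' l) x * B (b' k) (b' l)))"
    unfolding sum.cartesian_product[symmetric] sum_distrib_left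
    by (intro sum.cong refl) (simp add: T_def Gam_commute[of "b' _" "b _"] mult_ac)
  also have "\<dots> = (\<Sum>i<n. \<Sum>j<n. B (b i) (b j) * B (b i) (b j))"
    by (intro sum.cong refl) (simp add: quotient_form_expand[OF b' dim B, symmetric] bA)
  finally show ?thesis by (simp add: power2_eq_square)
qed

end

section \<open>Hilbert-Schmidt norms and completing the square\<close>

lemma HS_norm_upper:
  "orthonormal_at A L x {..<r} b \<Longrightarrow> ereal (sqrt (\<Sum>i<r. \<Sum>j<r. (B (b i) (b j))\<^sup>2)) \<le> HS_norm A L x B"
  unfolding HS_norm_def by (rule SUP_upper2[of "(r, b)"]) auto

lemma HS_norm_nonneg: "0 \<le> HS_norm A L x B"
  using HS_norm_upper[of A L x 0 undefined B] by (simp add: orthonormal_at_def zero_ereal_def)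

lemma le_HS_norm_sq:
  assumes "orthonormal_at A L x {..<r} b"
  shows "ereal (\<Sum>i<r. \<Sum>j<r. (B (b i) (b j))\<^sup>2) \<le> (HS_norm A L x B)\<^sup>2"
proof -
  define S where "S = (\<Sum>i<r. \<Sum>j<r. (B (b i) (b j))\<^sup>2)"
  have "0 \<le> S" unfolding S_def by (intro sum_nonneg) simp
  then have "ereal S = ereal (sqrt S) * ereal (sqrt S)" by simp
  also have "\<dots> \<le> HS_norm A L x B * HS_norm A L x B"
    using HS_norm_upper[OF assms, of B] \<open>0 \<le> S\<close>
    by (intro ereal_mult_mono) (auto simp: S_def HS_norm_nonneg)
  finally show ?thesis by (simp add: S_def power2_eq_square)
qed

text \<open>
  Together with the previous lemma this characterises the square of the norm as a supremum, without
  leaving the real numbers for the individual sums.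
\<close>
lemma HS_norm_sq_le:
  assumes "\<And>r b. orthonormal_at A L x {..<r} b \<Longrightarrow> (\<Sum>i<r. \<Sum>j<r. (B (b i) (b j))\<^sup>2) \<le> u"
  shows "(HS_norm A L x B)\<^sup>2 \<le> ereal u"
proof -
  have u: "0 \<le> u" using assms[of 0 undefined] by (simp add: orthonormal_at_def)
  have "HS_norm A L x B \<le> ereal (sqrt u)"
    unfolding HS_norm_def using assms by (intro SUP_least) auto
  then have "HS_norm A L x B * HS_norm A L x B \<le> ereal (sqrt u) * ereal (sqrt u)"
    by (intro ereal_mult_mono) (auto simp: HS_norm_nonneg u)
  then show ?thesis using u by (simp add: power2_eq_square)
qed

lemma double_sum_square_le:
  fixes h :: "nat \<Rightarrow> nat \<Rightarrow> real"
  assumes "m \<le> k"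
  shows "(\<Sum>i<m. \<Sum>j<m. (h i j)\<^sup>2) \<le> (\<Sum>i<k. \<Sum>j<k. (h i j)\<^sup>2)"
proof -
  have "(\<Sum>i<m. \<Sum>j<m. (h i j)\<^sup>2) \<le> (\<Sum>i<m. \<Sum>j<k. (h i j)\<^sup>2)"
    by (intro sum_mono sum_mono2) (use assms in auto)
  also have "\<dots> \<le> (\<Sum>i<k. \<Sum>j<k. (h i j)\<^sup>2)"
    by (intro sum_mono2) (use assms in \<open>auto intro: sum_nonneg\<close>)
  finally show ?thesis .
qed

lemma complete_square_sum:
  fixes a h :: "nat \<Rightarrow> nat \<Rightarrow> real"
  shows "(\<Sum>i<n. \<Sum>j<n. 2 * a i j * h i j + (a i j)\<^sup>2) =
    (\<Sum>i<n. \<Sum>j<n. (a i j + h i j)\<^sup>2) - (\<Sum>i<n. \<Sum>j<n. (h i j)\<^sup>2)"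
  unfolding sum_subtractf[symmetric]
  by (intro sum.cong refl) (simp add: power2_eq_square algebra_simps)

lemma complete_square_lower:
  fixes a h :: "nat \<Rightarrow> nat \<Rightarrow> real"
  shows "- (\<Sum>i<m. \<Sum>j<m. (h i j)\<^sup>2) \<le> (\<Sum>i<m. \<Sum>j<m. 2 * a i j * h i j + (a i j)\<^sup>2)"
  unfolding complete_square_sum by (simp add: sum_nonneg)

lemma recip_infinity: "recip \<infinity> = 0"
  by (simp add: recip_def)

context diffusion_operator
begin

section \<open>Bounds for the N-Ricci tensor\<close>

text \<open>
  Every symmetric matrix is the second derivative at \<open>p\<close> of some admissible \<open>\<psi>\<close>, namely of half the
  quadratic form centred at \<open>p\<close>, shifted by a constant so that it vanishes at the origin.
\<close>
lemma quadratic_perturbation: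
  fixes a :: "nat \<Rightarrow> nat \<Rightarrow> real" and p :: "nat \<Rightarrow> real"
  assumes a: "\<And>i j. i < r \<Longrightarrow> j < r \<Longrightarrow> a i j = a j i"
  obtains \<psi> where "smooth_in {..<r} \<psi>" "\<psi> (\<lambda>_. 0) = 0" "\<And>k. k < r \<Longrightarrow> partial_der k \<psi> p = 0"
    "\<And>k l. k < r \<Longrightarrow> l < r \<Longrightarrow> partial_der l (partial_der k \<psi>) p = a k l"
proof -
  define q where "q y = (\<Sum>i<r. \<Sum>j<r. (a i j / 2) * ((y i + - p i) * (y j + - p j)))" for y
  define \<psi> where "\<psi> y = q y + - q (\<lambda>_. 0)" for y
  have "q \<in> smooth_algebra {..<r}"
    unfolding q_def[abs_def] by (intro smooth_algebra_sum smooth_algebra.mult smooth_algebra.add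
        smooth_algebra.const smooth_algebra.proj) auto
  then have "\<psi> \<in> smooth_algebra {..<r}"
    unfolding \<psi>_def[abs_def] by (rule smooth_algebra.add[OF _ smooth_algebra.const])
  then have "smooth_in {..<r} \<psi>" by (rule smooth_algebra_imp_smooth_in)
  moreover have "\<psi> (\<lambda>_. 0) = 0" by (simp add: \<psi>_def)
  moreover have D: "partial_der k \<psi> = (\<lambda>y. \<Sum>j<r. a k j * (y j + - p j))" if k: "k < r" for k
  proof (intro ext partial_der_eqI)
    fix y :: "nat \<Rightarrow> real"
    let ?\<delta> = "\<lambda>i. if k = i then 1 else (0::real)"
    have lin: "((\<lambda>t. (y(k := t)) i + - p i) has_field_derivative ?\<delta> i) (at (y k))" for i
      using DERIV_add[OF coordinate_has_derivative[of y k i "y k"] DERIV_const[of "- p i"]] by simp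
    have "((\<lambda>t. \<psi> (y(k := t))) has_field_derivative
        (\<Sum>i<r. \<Sum>j<r. (a i j / 2) * (?\<delta> i * (y j + - p j) + ?\<delta> j * (y i + - p i))) + 0) (at (y k))"
      unfolding \<psi>_def q_def
      by (intro DERIV_add DERIV_const DERIV_sum DERIV_cmult)
         (use DERIV_mult[OF lin lin] in simp)
    also have "(\<Sum>i<r. \<Sum>j<r. (a i j / 2) * (?\<delta> i * (y j + - p j) + ?\<delta> j * (y i + - p i))) =
        (\<Sum>i<r. \<Sum>j<r. if k = i then a i j / 2 * (y j + - p j) else 0) +
        (\<Sum>i<r. \<Sum>j<r. if k = j then a i j / 2 * (y i + - p i) else 0)"
      unfolding sum.distrib[symmetric] by (intro sum.cong refl) (simp add: distrib_left)
    also have "(\<Sum>i<r. \<Sum>j<r. if k = i then a i j / 2 * (y j + - p j) else 0) =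
        (\<Sum>j<r. a k j / 2 * (y j + - p j))"
      by (subst sum.swap) (use k in \<open>simp add: sum.delta\<close>)
    also have "(\<Sum>i<r. \<Sum>j<r. if k = j then a i j / 2 * (y i + - p i) else 0) =
        (\<Sum>i<r. a k i / 2 * (y i + - p i))"
      using k by (intro sum.cong refl) (simp add: sum.delta a)
    also have "(\<Sum>j<r. a k j / 2 * (y j + - p j)) + (\<Sum>i<r. a k i / 2 * (y i + - p i)) + 0 =
        (\<Sum>j<r. a k j * (y j + - p j))"
      unfolding sum.distrib[symmetric] add_0_right by (intro sum.cong refl) (simp add: field_simps)
    finally show "((\<lambda>t. \<psi> (y(k := t))) has_field_derivative (\<Sum>j<r. a k j * (y j + - p j))) (at (y k))" .
  qed
  moreover have "partial_der k \<psi> p = 0" if "k < r" for k by (simp add: D[OF that])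
  moreover have "partial_der l (partial_der k \<psi>) p = a k l" if k: "k < r" and l: "l < r" for k l
  proof (rule partial_der_eqI)
    have lin: "((\<lambda>t. (p(l := t)) i + - p i) has_field_derivative (if l = i then 1 else 0)) (at (p l))" for i
      using DERIV_add[OF coordinate_has_derivative[of p l i "p l"] DERIV_const[of "- p i"]] by simp
    have "((\<lambda>t. partial_der k \<psi> (p(l := t))) has_field_derivative
        (\<Sum>j<r. a k j * (if l = j then 1 else 0))) (at (p l))"
      unfolding D[OF k] by (intro DERIV_sum DERIV_cmult lin)
    also have "(\<Sum>j<r. a k j * (if l = j then 1 else 0)) = (\<Sum>j<r. if l = j then a k j else 0)"
      by (intro sum.cong) auto
    also have "\<dots> = a k l" using l by simp
    finally show "((\<lambda>t. partial_der k \<psi> (p(l := t))) has_field_derivative a k l) (at (p l))" .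
  qed
  ultimately show thesis using that by blast
qed

text \<open>
  Upper bound: the perturbations by quadratic functions of any orthonormal system compete in the
  infimum that defines \<open>R\<^sub>N\<close>.
\<close>
lemma N_Ricci_le:
  assumes b: "orthonormal_at A L x {..<r} b" and f: "f \<in> A"
    and a: "\<And>i j. i < r \<Longrightarrow> j < r \<Longrightarrow> a i j = a j i"
  shows "N_Ricci A L N f x \<le>
    ereal (Gam2 L f f x + (\<Sum>i<r. \<Sum>j<r. 2 * a i j * Hess L f (b i) (b j) x + (a i j)\<^sup>2)
      - recip N * (L f x + (\<Sum>i<r. a i i))\<^sup>2)"
proof -
  obtain \<psi> where \<psi>: "smooth_in {..<r} \<psi>" "\<psi> (\<lambda>_. 0) = 0"
    and crit: "\<And>k. k < r \<Longrightarrow> partial_der k \<psi> (\<lambda>k. b k x) = 0"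
    and D2: "\<And>k l. k < r \<Longrightarrow> l < r \<Longrightarrow> partial_der l (partial_der k \<psi>) (\<lambda>k. b k x) = a k l"
    using quadratic_perturbation[where a=a and r=r and p="\<lambda>k. b k x"] a by blast
  define g where "g = (\<lambda>y. \<psi> (\<lambda>i. b i y))"
  have crit': "\<forall>i<r. partial_der i \<psi> (\<lambda>k. b k x) = 0" using crit by blast
  note P = second_order_perturbation[OF b f \<psi> crit' D2[symmetric], folded g_def]
  have "f + g - f = g" by auto
  then have "f + g \<in> {h \<in> A. Gam L (h - f) (h - f) x = 0}" using P(1,2) f by (simp add: add_mem)
  then have "N_Ricci A L N f x \<le> ereal (Gam2 L (f + g) (f + g) x - recip N * (L (f + g) x)\<^sup>2)"
    unfolding N_Ricci_def by (rule INF_lower)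
  also have "L (f + g) x = L f x + (\<Sum>i<r. a i i)" using P(3) by (simp add: L_add[OF f P(1)])
  finally show ?thesis by (simp only: P(4))
qed

text \<open>
  What regularity says after evaluation at \<open>x\<close>: the values of \<open>\<Gamma>\<^sub>2\<close> and of \<open>L\<close> for an arbitrary null
  perturbation \<open>g\<close> of \<open>f\<close> are limits of the values obtained from symmetric matrices \<open>a r\<close> in the regular
  system. The constants \<open>\<psi> r 0\<close> are removed by the lemmas on the extension of \<open>L\<close>.
\<close>
lemma regular_approximation:
  assumes reg: "regular_orthonormal_system A L x I e" and f: "f \<in> A"
    and g: "g \<in> A" "Gam L g g x = 0"
  obtains m :: "nat \<Rightarrow> nat" and a :: "nat \<Rightarrow> nat \<Rightarrow> nat \<Rightarrow> real" where
    "\<And>r. {..<m r} \<subseteq> I" "\<And>r i j. i < m r \<Longrightarrow> j < m r \<Longrightarrow> a r i j = a r j i"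
    "(\<lambda>r. Gam2 L f f x + (\<Sum>i<m r. \<Sum>j<m r. 2 * a r i j * Hess L f (e i) (e j) x + (a r i j)\<^sup>2))
      \<longlonglongrightarrow> Gam2 L (f + g) (f + g) x"
    "dim_at A L x < \<infinity> \<Longrightarrow> (\<lambda>r. \<Sum>i<m r. a r i i) \<longlonglongrightarrow> L g x"
proof -
  have I: "I = UNIV \<or> (\<exists>n. I = {..<n})" and e: "orthonormal_at A L x I e"
    and "regular_system A L x I e"
    using reg by (auto simp: regular_orthonormal_system_def)
  then have "\<exists>\<psi> :: nat \<Rightarrow> (nat \<Rightarrow> real) \<Rightarrow> real.
      (\<forall>r. smooth_in (I \<inter> {..<r}) (\<psi> r) \<and>
        (\<forall>i \<in> I \<inter> {..<r}. partial_der i (\<psi> r) (\<lambda>j. e j x) = 0)) \<and>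
      (\<lambda>r. Gam2 (ext A L) (f + (\<lambda>y. \<psi> r (\<lambda>j. e j y))) (f + (\<lambda>y. \<psi> r (\<lambda>j. e j y))) x)
        \<longlonglongrightarrow> Gam2 L (f + g) (f + g) x \<and>
      (dim_at A L x < \<infinity> \<longrightarrow> (\<lambda>r. ext A L (\<lambda>y. \<psi> r (\<lambda>j. e j y)) x) \<longlonglongrightarrow> L g x)"
    unfolding regular_system_def Let_def by (elim ballE[of _ _ f] ballE[of _ _ g] impE) (use f g in blast)+
  then obtain \<psi> where \<psi>: "\<And>r. smooth_in (I \<inter> {..<r}) (\<psi> r)"
    and crit: "\<And>r i. i \<in> I \<inter> {..<r} \<Longrightarrow> partial_der i (\<psi> r) (\<lambda>j. e j x) = 0"
    and lim2: "(\<lambda>r. Gam2 (ext A L) (f + (\<lambda>y. \<psi> r (\<lambda>j. e j y))) (f + (\<lambda>y. \<psi> r (\<lambda>j. e j y))) x)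
        \<longlonglongrightarrow> Gam2 L (f + g) (f + g) x"
    and lim1: "dim_at A L x < \<infinity> \<Longrightarrow> (\<lambda>r. ext A L (\<lambda>y. \<psi> r (\<lambda>j. e j y)) x) \<longlonglongrightarrow> L g x"
    by blast
  have "\<exists>m. I \<inter> {..<r} = {..<m}" for r
  proof (cases "I = UNIV")
    case False
    then obtain n where "I = {..<n}" using I by blast
    then have "I \<inter> {..<r} = {..<min n r}" by auto
    then show ?thesis by blast
  qed auto
  then obtain m where m: "\<And>r. I \<inter> {..<r} = {..<m r}" by metis
  define \<phi> where "\<phi> r y = \<psi> r y + - \<psi> r (\<lambda>_. 0)" for r y
  define a where "a r i j = partial_der j (partial_der i (\<phi> r)) (\<lambda>k. e k x)" for r i j
  define h where "h r = (\<lambda>y. \<phi> r (\<lambda>i. e i y))" for r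
  have \<psi>m: "smooth_in {..<m r} (\<psi> r)" for r using \<psi>[of r] m by simp
  have "\<phi> r \<in> smooth_algebra {..<m r}" for r
    unfolding \<phi>_def[abs_def]
    by (rule smooth_algebra.add[OF smooth_algebra.base[OF \<psi>m order_refl] smooth_algebra.const])
  then have \<phi>: "smooth_in {..<m r} (\<phi> r)" for r by (rule smooth_algebra_imp_smooth_in)
  have \<phi>0: "\<phi> r (\<lambda>_. 0) = 0" for r by (simp add: \<phi>_def)
  have "partial_der i (\<phi> r) = partial_der i (\<psi> r)" if "i < m r" for r i
  proof -
    have c: "partially_differentiable i (\<lambda>_. - \<psi> r (\<lambda>_. 0))"
      by (simp add: partially_differentiable_def)
    have p: "partially_differentiable i (\<psi> r)" using smooth_inD(3)[OF \<psi>m] that by simp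
    show ?thesis
      unfolding \<phi>_def[abs_def] partial_der_add[OF p c] partial_der_const by simp
  qed
  then have crit': "\<forall>i<m r. partial_der i (\<phi> r) (\<lambda>k. e k x) = 0" for r
    using crit[of _ r] m[of r] by auto
  have mI: "{..<m r} \<subseteq> I" for r using m[of r] by blast
  have em: "orthonormal_at A L x {..<m r} e" for r
    by (rule orthonormal_at_subset[OF e mI])
  note P = second_order_perturbation[OF em f \<phi> \<phi>0 crit' a_def, folded h_def]
  \<comment> \<open>The normalised perturbations \<open>h r\<close> lie in \<open>A\<close> and differ from the given ones by constants.\<close>
  have shift: "(\<lambda>y. \<psi> r (\<lambda>j. e j y)) = h r + (\<lambda>_. \<psi> r (\<lambda>_. 0))" for r
    by (auto simp: h_def \<phi>_def)
  have fshift: "f + (\<lambda>y. \<psi> r (\<lambda>j. e j y)) = (f + h r) + (\<lambda>_. \<psi> r (\<lambda>_. 0))" for r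
    by (simp only: shift add.assoc)
  have "Gam2 (ext A L) (f + (\<lambda>y. \<psi> r (\<lambda>j. e j y))) (f + (\<lambda>y. \<psi> r (\<lambda>j. e j y))) x =
     Gam2 L f f x + (\<Sum>i<m r. \<Sum>j<m r. 2 * a r i j * Hess L f (e i) (e j) x + (a r i j)\<^sup>2)" for r
    unfolding fshift Gam2_ext_add_const[OF add_mem[OF f P(1)]] by (rule P(4))
  note l2 = lim2[unfolded this]
  have "ext A L (\<lambda>y. \<psi> r (\<lambda>j. e j y)) x = (\<Sum>i<m r. a r i i)" for r
    unfolding shift ext_add_const[OF P(1)] by (rule P(3))
  note l1 = lim1[unfolded this]
  have sym: "a r i j = a r j i" if "i < m r" "j < m r" for r i j
    using partial_der_commute[OF \<phi>, of j r i] that by (simp add: a_def)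
  show thesis by (rule that[OF mI sym l2 l1])
qed

text \<open>
  Lower bound: by regularity, a bound for all symmetric matrices in the system \<open>e\<close> passes to the
  limit and bounds all competitors. If \<open>1/N = 0\<close>, convergence of \<open>\<Gamma>\<^sub>2\<close> suffices; otherwise convergence
  of \<open>L\<close> enters, which regularity grants in finite dimension.
\<close>
lemma N_Ricci_ge:
  assumes reg: "regular_orthonormal_system A L x I e" and f: "f \<in> A"
    and N: "recip N = 0 \<or> dim_at A L x < \<infinity>"
    and bound: "\<And>m a. {..<m} \<subseteq> I \<Longrightarrow> (\<And>i j. i < m \<Longrightarrow> j < m \<Longrightarrow> a i j = a j i) \<Longrightarrow>
      B \<le> Gam2 L f f x + (\<Sum>i<m. \<Sum>j<m. 2 * a i j * Hess L f (e i) (e j) x + (a i j)\<^sup>2)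
        - recip N * (L f x + (\<Sum>i<m. a i i))\<^sup>2"
  shows "ereal B \<le> N_Ricci A L N f x"
  unfolding N_Ricci_def
proof (rule INF_greatest)
  fix h assume "h \<in> {h \<in> A. Gam L (h - f) (h - f) x = 0}"
  then have h: "h \<in> A" "Gam L (h - f) (h - f) x = 0" by auto
  define g where "g = h - f"
  have g: "g \<in> A" "Gam L g g x = 0" using h f by (simp_all add: g_def diff_mem)
  have fg: "f + g = h" by (auto simp: g_def)
  obtain m a where ma: "\<And>r. {..<m r} \<subseteq> I" "\<And>r i j. i < m r \<Longrightarrow> j < m r \<Longrightarrow> a r i j = a r j i"
    and lim2: "(\<lambda>r. Gam2 L f f x + (\<Sum>i<m r. \<Sum>j<m r. 2 * a r i j * Hess L f (e i) (e j) x + (a r i j)\<^sup>2))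
      \<longlonglongrightarrow> Gam2 L (f + g) (f + g) x"
    and lim1: "dim_at A L x < \<infinity> \<Longrightarrow> (\<lambda>r. \<Sum>i<m r. a r i i) \<longlonglongrightarrow> L g x"
    using regular_approximation[OF reg f g] by blast
  have "(\<lambda>r. recip N * (L f x + (\<Sum>i<m r. a r i i))\<^sup>2) \<longlonglongrightarrow> recip N * (L f x + L g x)\<^sup>2"
  proof (cases "recip N = 0")
    case False
    then show ?thesis using N lim1 by (intro tendsto_intros) auto
  qed simp
  from tendsto_diff[OF lim2 this]
  have "B \<le> Gam2 L (f + g) (f + g) x - recip N * (L f x + L g x)\<^sup>2"
    by (rule LIMSEQ_le_const) (intro exI[of _ 0] allI impI bound ma)
  moreover have "L h x = L f x + L g x" using L_add[OF f g(1)] by (simp add: fg)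
  ultimately show "ereal B \<le> ereal (Gam2 L h h x - recip N * (L h x)\<^sup>2)" by (simp add: fg)
qed

section \<open>The Ricci tensor and the Hessian\<close>

lemma Ricci_le:
  assumes "orthonormal_at A L x {..<r} b" "f \<in> A"
  shows "Ricci A L f x \<le> ereal (Gam2 L f f x - (\<Sum>i<r. \<Sum>j<r. (Hess L f (b i) (b j) x)\<^sup>2))"
proof -
  have "Ricci A L f x \<le> ereal (Gam2 L f f x +
      (\<Sum>i<r. \<Sum>j<r. 2 * (- Hess L f (b i) (b j) x) * Hess L f (b i) (b j) x + (- Hess L f (b i) (b j) x)\<^sup>2)
      - recip \<infinity> * (L f x + (\<Sum>i<r. - Hess L f (b i) (b i) x))\<^sup>2)"
    unfolding Ricci_def by (rule N_Ricci_le[OF assms]) (simp add: Hess_commute)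
  then show ?thesis by (simp add: recip_infinity power2_eq_square sum_negf)
qed

lemma Ricci_ge:
  assumes reg: "regular_orthonormal_system A L x I e" and f: "f \<in> A"
    and K: "\<And>m. {..<m} \<subseteq> I \<Longrightarrow> (\<Sum>i<m. \<Sum>j<m. (Hess L f (e i) (e j) x)\<^sup>2) \<le> K"
  shows "ereal (Gam2 L f f x - K) \<le> Ricci A L f x"
  unfolding Ricci_def
proof (rule N_Ricci_ge[OF reg f])
  fix m and a :: "nat \<Rightarrow> nat \<Rightarrow> real" assume "{..<m} \<subseteq> I"
  then show "Gam2 L f f x - K \<le> Gam2 L f f x +
      (\<Sum>i<m. \<Sum>j<m. 2 * a i j * Hess L f (e i) (e j) x + (a i j)\<^sup>2)
      - recip \<infinity> * (L f x + (\<Sum>i<m. a i i))\<^sup>2"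
    using K[of m] complete_square_lower[where m=m and h="\<lambda>i j. Hess L f (e i) (e j) x" and a=a]
    by (simp add: recip_infinity)
qed (simp add: recip_infinity)

text \<open>
  Completing the square, \<open>2 a\<^sub>i\<^sub>j h\<^sub>i\<^sub>j + a\<^sub>i\<^sub>j\<^sup>2 = (a\<^sub>i\<^sub>j + h\<^sub>i\<^sub>j)\<^sup>2 - h\<^sub>i\<^sub>j\<^sup>2\<close>, the optimal matrix is
      \<open>a = - h\<close>. The
  upper bound ranges over all orthonormal systems and so produces the norm, the lower bound only
  uses the regular one, whose sums are below the norm.
\<close>
lemma Ricci_eq:
  assumes reg: "regular_orthonormal_system A L x I e" and f: "f \<in> A"
  shows "Ricci A L f x = ereal (Gam2 L f f x) - (HS_norm A L x (\<lambda>g h. Hess L f g h x))\<^sup>2"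
    (is "_ = _ - ?H\<^sup>2")
proof (rule antisym)
  have le: "Ricci A L f x \<le> ereal (Gam2 L f f x - (\<Sum>i<r. \<Sum>j<r. (Hess L f (b i) (b j) x)\<^sup>2))"
    if "orthonormal_at A L x {..<r} b" for r b by (rule Ricci_le[OF that f])
  show "Ricci A L f x \<le> ereal (Gam2 L f f x) - ?H\<^sup>2"
  proof (cases "Ricci A L f x")
    case (real \<rho>)
    have "?H\<^sup>2 \<le> ereal (Gam2 L f f x - \<rho>)"
      by (rule HS_norm_sq_le) (use le real in force)
    then show ?thesis using real HS_norm_nonneg[of A L x] by (cases "?H\<^sup>2") auto
  next
    case PInf
    then show ?thesis using le[of 0 undefined] by (simp add: orthonormal_at_def)
  qed simp
  have e: "orthonormal_at A L x I e" using reg by (simp add: regular_orthonormal_system_def)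
  show "ereal (Gam2 L f f x) - ?H\<^sup>2 \<le> Ricci A L f x"
  proof (cases "?H\<^sup>2")
    case (real K)
    have "ereal (Gam2 L f f x - K) \<le> Ricci A L f x"
    proof (rule Ricci_ge[OF reg f])
      fix m assume "{..<m} \<subseteq> I"
      from le_HS_norm_sq[OF orthonormal_at_subset[OF e this], of "\<lambda>g h. Hess L f g h x"]
      show "(\<Sum>i<m. \<Sum>j<m. (Hess L f (e i) (e j) x)\<^sup>2) \<le> K" by (simp add: real)
    qed
    then show ?thesis using real by simp
  next
    case MInf
    then show ?thesis using le_HS_norm_sq[of A L x 0 undefined "\<lambda>g h. Hess L f g h x"]
      by (simp add: orthonormal_at_def)
  qed simp
qed

text \<open>
  For a general diffusion operator the Hessian does not descend to the quotient: in the Heisenberg group,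
  \<open>H\<^sub>f(g, h)\<close> involves the commutator of two horizontal fields applied to the null function \<open>g\<close>.
  Regularity excludes this. In finite dimension it yields a finite lower bound for the Ricci tensor,
  and hence, by the upper bound for arbitrary systems, a bound for \<open>H\<^sub>f(u, u)\<close> that is uniform over all
  unit vectors \<open>u\<close>. Since \<open>u + t g\<close> is a unit vector for every null \<open>g\<close> and every \<open>t\<close>, the terms of this
  quadratic polynomial in \<open>t\<close> that depend on \<open>g\<close> must vanish.
\<close>
lemma quotient_form_Hess:
  assumes reg: "regular_orthonormal_system A L x I e" and f: "f \<in> A" and dim: "dim_at A L x = enat n"
  shows "quotient_form A L x (\<lambda>g h. Hess L f g h x)"
proof -
  define B where "B g h = Hess L f g h x" for g h
  have lin: "linear_on A (\<lambda>g. B g h)" if "h \<in> A" for h unfolding B_def by (rule linear_on_Hess[OF f that])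
  have sym: "B g h = B h g" for g h unfolding B_def by (rule Hess_commute)
  have add: "B (g + g') h = B g h + B g' h" if "g \<in> A" "g' \<in> A" "h \<in> A" for g g' h
    using lin that unfolding linear_on_def by blast
  have scale: "B (\<lambda>y. c * g y) h = c * B g h" if "g \<in> A" "h \<in> A" for g h c
    using lin that unfolding linear_on_def by blast
  have I: "I = UNIV \<or> (\<exists>n. I = {..<n})" and e: "orthonormal_at A L x I e"
    using reg by (auto simp: regular_orthonormal_system_def)
  \<comment> \<open>An infinite orthonormal system would force infinite dimension.\<close>
  have "I \<noteq> UNIV"
  proof
    assume "I = UNIV"
    then have "orthonormal_at A L x {..<Suc n} e" using orthonormal_at_subset[OF e] by simp
    from orthonormal_le_dim[OF this] show False by (simp add: dim)
  qed
  then obtain k where k: "I = {..<k}" using I by blast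
  define K where "K = (\<Sum>i<k. \<Sum>j<k. (Hess L f (e i) (e j) x)\<^sup>2)"
  have "ereal (Gam2 L f f x - K) \<le> Ricci A L f x"
    by (rule Ricci_ge[OF reg f]) (simp add: K_def k double_sum_square_le)
  also have "\<dots> \<le> ereal (Gam2 L f f x - (\<Sum>i<r. \<Sum>j<r. (Hess L f (b i) (b j) x)\<^sup>2))"
    if "orthonormal_at A L x {..<r} b" for r b by (rule Ricci_le[OF that f])
  finally have K: "(\<Sum>i<r. \<Sum>j<r. (Hess L f (b i) (b j) x)\<^sup>2) \<le> K"
    if "orthonormal_at A L x {..<r} b" for r b using that by simp
  have diag: "\<bar>B u u\<bar> \<le> sqrt K" if "u \<in> A" "Gam L u u x = 1" for u
  proof -
    have "orthonormal_at A L x {..<1} (\<lambda>_. u)" using that by (simp add: orthonormal_at_def)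
    from K[OF this] have "(B u u)\<^sup>2 \<le> K" by (simp add: B_def)
    then show ?thesis using real_sqrt_le_mono by fastforce
  qed
  have zero: "B u g = 0 \<and> B g g = 0" if u: "u \<in> A" "Gam L u u x = 1" and g: "g \<in> A" "Gam L g g x = 0"
      for u g
  proof -
    have "\<bar>B u u + (2 * B u g) * t + B g g * t\<^sup>2\<bar> \<le> sqrt K" for t
    proof -
      define s where "s = (\<lambda>y. t * g y)"
      have s: "s \<in> A" unfolding s_def by (rule scale_mem[OF g(1)])
      have sh: "Gam L s h x = 0" if "h \<in> A" for h
        unfolding s_def using Gam_scale_left[OF g(1) that] Gam_null[OF g that] by simp
      have "Gam L (u + s) (u + s) x = 1"
        using u s sh[OF s] sh[OF u(1)] Gam_commute[of u s] by (simp add: Gam_self_add)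
      then have "\<bar>B (u + s) (u + s)\<bar> \<le> sqrt K" by (intro diag add_mem u s)
      moreover have "B (u + s) (u + s) = B u u + 2 * B s u + B s s"
        using add[OF u(1) s add_mem[OF u(1) s]] add[OF u(1) s u(1)] add[OF u(1) s s]
          sym[of u "u + s"] sym[of s "u + s"] sym[of u s] by simp
      moreover have "B s u = t * B u g"
        unfolding s_def using scale[OF g(1) u(1)] sym[of g u] by simp
      moreover have "B s s = t * (t * B g g)"
        using scale[OF g(1) s, of t] scale[OF g(1) g(1), of t] sym[of g s] unfolding s_def[symmetric] by
            simp
      ultimately show ?thesis by (simp add: power2_eq_square algebra_simps)
    qed
    from bounded_quadratic_trivial[OF this] show ?thesis by simp
  qed
  have unit: "\<exists>u c. u \<in> A \<and> Gam L u u x = 1 \<and> h = (\<lambda>y. c * u y)" if h: "h \<in> A" "Gam L h h x \<noteq> 0" for h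
  proof -
    define c where "c = sqrt (Gam L h h x)"
    have "Gam L h h x > 0" using h Gam_nonneg[of h x] by simp
    then have c: "c \<noteq> 0" "Gam L h h x = c * c" by (simp_all add: c_def)
    have u: "(\<lambda>y. 1 / c * h y) \<in> A" by (rule scale_mem[OF h(1)])
    have "Gam L (\<lambda>y. 1 / c * h y) (\<lambda>y. 1 / c * h y) x = 1 / c * (1 / c * Gam L h h x)"
      using Gam_scale_left[OF h(1) u, of "1 / c" x] Gam_scale_right[OF h(1) h(1), of "1 / c" x] by simp
    then have "Gam L (\<lambda>y. 1 / c * h y) (\<lambda>y. 1 / c * h y) x = 1" using c by simp
    moreover have "h = (\<lambda>y. c * (1 / c * h y))" using c by simp
    ultimately show ?thesis using u by blast
  qed
  have "B g h = 0" if g: "g \<in> A" "Gam L g g x = 0" and h: "h \<in> A" for g h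
  proof (cases "Gam L h h x = 0")
    case False
    then obtain u c where u: "u \<in> A" "Gam L u u x = 1" "h = (\<lambda>y. c * u y)" using unit[OF h] by blast
    have "B h g = c * B u g" unfolding u(3) by (rule scale[OF u(1) g(1)])
    then show ?thesis using zero[OF u(1,2) g] sym[of g h] by simp
  next
    case True
    show ?thesis
    proof (cases "\<exists>v\<in>A. Gam L v v x \<noteq> 0")
      case True
      then obtain u where u: "u \<in> A" "Gam L u u x = 1" using unit by blast
      have "Gam L (g + h) (g + h) x = 0"
        using g h \<open>Gam L h h x = 0\<close> Gam_null[OF g h] by (simp add: Gam_self_add)
      then have "B (g + h) (g + h) = 0" using zero[OF u add_mem[OF g(1) h]] by blast
      moreover have "B g g = 0" "B h h = 0" using zero[OF u] g h \<open>Gam L h h x = 0\<close> by blast+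
      moreover have "B (g + h) (g + h) = B g g + 2 * B g h + B h h"
        using add[OF g(1) h add_mem[OF g(1) h]] add[OF g(1) h g(1)] add[OF g(1) h h]
          sym[of g "g + h"] sym[of h "g + h"] sym[of h g] by simp
      ultimately show ?thesis by simp
    next
      case False
      \<comment> \<open>All functions are null, \<open>f\<close> included, so every term of the Hessian vanishes.\<close>
      then have "Gam L v w x = 0" if "v \<in> A" "w \<in> A" for v w using Gam_null that by blast
      then show ?thesis using f g(1) h by (simp add: B_def Hess_def Gam_mem)
    qed
  qed
  then show ?thesis using lin sym unfolding quotient_form_def B_def by blast
qed

end

section \<open>Minimising over symmetric matrices\<close>

lemma trace_square_le:
  fixes b :: "nat \<Rightarrow> nat \<Rightarrow> real"
  shows "(\<Sum>i<n. b i i)\<^sup>2 \<le> real n * (\<Sum>i<n. \<Sum>j<n. (b i j)\<^sup>2)"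
proof -
  have "(\<Sum>i<n. b i i)\<^sup>2 \<le> (\<Sum>i<n. (b i i)\<^sup>2) * card {..<n}"
    by (rule sum_squared_le_sum_of_squares)
  also have "\<dots> \<le> (\<Sum>i<n. \<Sum>j<n. (b i j)\<^sup>2) * card {..<n}"
    by (intro mult_right_mono sum_mono member_le_sum) auto
  finally show ?thesis by (simp add: mult.commute)
qed

text \<open>
  The dimensional estimate: minimise \<open>t\<^sup>2 / n - k (c + t)\<^sup>2\<close> over the trace \<open>t\<close>. Here \<open>S\<close> stands for
  the sum of the squared entries of a matrix with trace \<open>t\<close>, and \<open>k\<close> for \<open>1/N\<close>.
\<close>
lemma square_sum_le:
  fixes c t S k n :: real
  assumes t: "t\<^sup>2 \<le> n * S" and n: "n = 0 \<Longrightarrow> S = 0" "n \<ge> 0" and k: "k \<ge> 0" "k * n < 1"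
  shows "k * (c + t)\<^sup>2 \<le> k / (1 - k * n) * c\<^sup>2 + S"
proof -
  define d where "d = 1 - k * n"
  have d: "d > 0" using k by (simp add: d_def)
  have S: "S \<ge> 0"
  proof (cases "n = 0")
    case False
    then have "n > 0" using n(2) by simp
    then show ?thesis using order_trans[OF zero_le_power2 t] by (simp add: zero_le_mult_iff)
  qed (simp add: n)
  have "d * (k * (c + t)\<^sup>2) \<le> k * c\<^sup>2 + d * S"
  proof (cases "n = 0")
    case True
    then have "t = 0" using t by simp
    then show ?thesis using True n by (simp add: d_def)
  next
    case False
    then have n0: "n > 0" using n(2) by simp
    \<comment> \<open>The square that vanishes at the minimising trace \<open>t = k n c / d\<close>.\<close>
    have "0 \<le> (k * n * c - d * t)\<^sup>2" by simp
    then have "n * (d * (k * (c + t)\<^sup>2)) \<le> n * (k * c\<^sup>2) + d * t\<^sup>2"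
      by (simp add: d_def power2_eq_square algebra_simps)
    also have "\<dots> \<le> n * (k * c\<^sup>2) + d * (n * S)" using t d by (simp add: mult_left_mono)
    also have "\<dots> = n * (k * c\<^sup>2 + d * S)" by (simp add: algebra_simps)
    finally show ?thesis using n0 by simp
  qed
  then have "k * (c + t)\<^sup>2 \<le> (k * c\<^sup>2 + d * S) / d" using d by (simp add: field_simps)
  then show ?thesis using d by (simp add: add_divide_distrib d_def)
qed

text \<open>
  With \<open>k = 1/N\<close> and \<open>n < N\<close>, the factor \<open>k / (1 - k n)\<close> is \<open>1 / (N - n)\<close>; this form covers \<open>N = \<infinity>\<close>.
\<close>
lemma quadratic_lower_subcritical:
  fixes a h :: "nat \<Rightarrow> nat \<Rightarrow> real"
  assumes k: "k \<ge> 0" "k * real n < 1"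
  shows "- (\<Sum>i<n. \<Sum>j<n. (h i j)\<^sup>2) - k / (1 - k * n) * (l - (\<Sum>i<n. h i i))\<^sup>2
    \<le> (\<Sum>i<n. \<Sum>j<n. 2 * a i j * h i j + (a i j)\<^sup>2) - k * (l + (\<Sum>i<n. a i i))\<^sup>2"
proof -
  define S where "S = (\<Sum>i<n. \<Sum>j<n. (a i j + h i j)\<^sup>2)"
  define t where "t = (\<Sum>i<n. a i i + h i i)"
  have "t\<^sup>2 \<le> real n * S" unfolding t_def S_def by (rule trace_square_le)
  then have "k * ((l - (\<Sum>i<n. h i i)) + t)\<^sup>2 \<le> k / (1 - k * n) * (l - (\<Sum>i<n. h i i))\<^sup>2 + S"
    by (rule square_sum_le) (use k in \<open>auto simp: S_def\<close>)
  moreover have "(l - (\<Sum>i<n. h i i)) + t = l + (\<Sum>i<n. a i i)" by (simp add: t_def sum.distrib)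
  ultimately show ?thesis unfolding complete_square_sum by (simp add: S_def)
qed

text \<open>
  The case \<open>N = n\<close>, where the affine term in the trace has to vanish for the infimum to be finite.
\<close>
lemma quadratic_lower_critical:
  fixes a h :: "nat \<Rightarrow> nat \<Rightarrow> real"
  assumes k: "k * real n = 1" and l: "l = (\<Sum>i<n. h i i)"
  shows "- (\<Sum>i<n. \<Sum>j<n. (h i j)\<^sup>2)
    \<le> (\<Sum>i<n. \<Sum>j<n. 2 * a i j * h i j + (a i j)\<^sup>2) - k * (l + (\<Sum>i<n. a i i))\<^sup>2"
proof -
  have n: "n > 0" using k by (cases n) auto
  then have k0: "k > 0" using k by (metis of_nat_0_less_iff zero_less_mult_pos2 zero_less_one)
  have "k * (\<Sum>i<n. a i i + h i i)\<^sup>2 \<le> k * (real n * (\<Sum>i<n. \<Sum>j<n. (a i j + h i j)\<^sup>2))"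
    by (intro mult_left_mono trace_square_le) (use k0 in simp)
  also have "\<dots> = (\<Sum>i<n. \<Sum>j<n. (a i j + h i j)\<^sup>2)" using k by (simp add: mult.assoc[symmetric])
  finally show ?thesis unfolding complete_square_sum l by (simp add: sum.distrib add.commute)
qed

text \<open>
  The polynomial in \<open>s\<close> has leading coefficient \<open>r (1 - k r)\<close> and linear coefficient \<open>- 2 k r c\<close>.
\<close>
lemma unbounded_below_quadratic:
  fixes k :: real
  assumes "k * r > 1 \<or> k * r = 1 \<and> c \<noteq> 0" "k \<ge> 0" "r \<ge> 0"
  shows "\<exists>s. r * s\<^sup>2 - k * (c + r * s)\<^sup>2 < B"
proof -
  have r: "r > 0" and k: "k > 0" using assms by (auto intro: order.not_eq_order_implies_strict)
  have eq: "r * s\<^sup>2 - k * (c + r * s)\<^sup>2 = - (r * (k * r - 1)) * s\<^sup>2 - 2 * (k * r) * c * s - k * c\<^sup>2" for s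
    by (simp add: power2_eq_square algebra_simps)
  \<comment> \<open>With the sign of \<open>c\<close>, the linear term is nonpositive.\<close>
  define \<sigma> where "\<sigma> = (if c < 0 then - 1 else 1 :: real)"
  have c\<sigma>: "c * \<sigma> = \<bar>c\<bar>" "\<sigma>\<^sup>2 = 1" by (auto simp: \<sigma>_def)
  show ?thesis
  proof (cases "k * r > 1")
    case True
    define \<delta> where "\<delta> = r * (k * r - 1)"
    have \<delta>: "\<delta> > 0" using True r by (simp add: \<delta>_def)
    define u where "u = sqrt ((\<bar>B\<bar> + 1) / \<delta>)"
    have u: "u \<ge> 0" "\<delta> * u\<^sup>2 = \<bar>B\<bar> + 1" using \<delta> by (simp_all add: u_def)
    have "r * (\<sigma> * u)\<^sup>2 - k * (c + r * (\<sigma> * u))\<^sup>2 = - (\<delta> * u\<^sup>2) - 2 * (k * r) * (\<bar>c\<bar> * u) - k * c\<^sup>2"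
      unfolding eq \<delta>_def c\<sigma>(1)[symmetric] by (simp add: power_mult_distrib c\<sigma>(2))
    also have "\<dots> \<le> - (\<delta> * u\<^sup>2)"
    proof -
      have "0 \<le> 2 * (k * r) * (\<bar>c\<bar> * u)" "0 \<le> k * c\<^sup>2" using k r u(1) by simp_all
      then show ?thesis by linarith
    qed
    also have "\<dots> < B" using u(2) by simp
    finally show ?thesis by blast
  next
    case False
    then have kr: "k * r = 1" and c: "c \<noteq> 0" using assms by auto
    define u where "u = (\<bar>B\<bar> + 1) / (2 * c)"
    have "r * u\<^sup>2 - k * (c + r * u)\<^sup>2 = - (\<bar>B\<bar> + 1) - k * c\<^sup>2"
      unfolding eq kr using c by (simp add: u_def)
    also have "\<dots> \<le> - (\<bar>B\<bar> + 1)" using k by simp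
    also have "\<dots> < B" by simp
    finally show ?thesis by blast
  qed
qed

section \<open>The dimension term as an extended real limit\<close>

lemma recip_ereal: "0 < a \<Longrightarrow> recip (ereal a) = 1 / a"
  by (simp add: recip_def one_ereal_def)

lemma quot_term_supercritical:
  assumes "ereal (real n) < N"
  shows "quot_term n q N = ereal (recip (N - ereal (real n)) * q N)"
  using assms by (auto simp: quot_term_def)

lemma recip_diff:
  assumes "1 \<le> N" "ereal (real n) < N"
  shows "recip N \<ge> 0" "recip N * real n < 1"
    "recip (N - ereal (real n)) = recip N / (1 - recip N * real n)"
proof -
  have "recip N \<ge> 0 \<and> recip N * real n < 1 \<and> recip (N - ereal (real n)) = recip N / (1 - recip N * real n)"
  proof (cases N)
    case (real a)
    then show ?thesis using assms by (simp add: recip_ereal one_ereal_def field_simps)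
  qed (use assms in \<open>auto simp: recip_infinity\<close>)
  then show "recip N \<ge> 0" "recip N * real n < 1"
    "recip (N - ereal (real n)) = recip N / (1 - recip N * real n)" by auto
qed

lemma quot_term_critical:
  assumes "((\<lambda>M. ereal (q (ereal M) / (M - real n))) \<longlongrightarrow> l) (at_right (real n))"
  shows "quot_term n q (ereal (real n)) = l"
proof -
  have "\<forall>\<^sub>F M in at_right (real n). ereal (q (ereal M) / (M - real n)) =
      ereal (recip (ereal M - ereal (real n)) * q (ereal M))"
    using eventually_at_right_less by eventually_elim (simp add: recip_ereal)
  with assms have "((\<lambda>M. ereal (recip (ereal M - ereal (real n)) * q (ereal M))) \<longlongrightarrow> l) (at_right (real n))"
    by (rule Lim_transform_eventually)
  then have "((\<lambda>M. ereal (recip (M - ereal (real n)) * q M)) \<longlongrightarrow> l) (at_right (ereal (real n)))"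
    unfolding at_right_ereal by (simp add: filterlim_filtermap)
  moreover have "at_right (ereal (real n)) \<noteq> bot" unfolding at_right_ereal by (simp add: filtermap_bot_iff)
  ultimately show ?thesis unfolding quot_term_def Let_def by (simp add: tendsto_Lim)
qed

text \<open>
  The numerator \<open>q\<close> may depend on \<open>M\<close>, as it does in the second of the two dimensional identities.
\<close>
lemma quot_term_critical_infinite:
  assumes "((\<lambda>M. q (ereal M)) \<longlongrightarrow> d) (at_right (real n))" "d > 0"
  shows "quot_term n q (ereal (real n)) = \<infinity>"
proof (rule quot_term_critical)
  have "filterlim (\<lambda>M. M - real n) (at_right 0) (at_right (real n))"
    unfolding filterlim_at using eventually_at_right_less[of "real n"]
    by (auto intro!: tendsto_eq_intros elim: eventually_mono)
  from filterlim_compose[OF filterlim_inverse_at_top_right this]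
  have "filterlim (\<lambda>M. q (ereal M) * inverse (M - real n)) at_top (at_right (real n))"
    by (rule filterlim_tendsto_pos_mult_at_top[OF assms])
  then show "((\<lambda>M. ereal (q (ereal M) / (M - real n))) \<longlongrightarrow> \<infinity>) (at_right (real n))"
    unfolding tendsto_PInfty_eq_at_top by (simp add: divide_inverse)
qed

context diffusion_operator
begin

section \<open>The N-Ricci tensor in finite and infinite dimension\<close>

lemma HS_norm_sq_basis:
  assumes b: "orthonormal_at A L x {..<n} b" and dim: "dim_at A L x = enat n" and B: "quotient_form A L x B"
  shows "(HS_norm A L x B)\<^sup>2 = ereal (\<Sum>i<n. \<Sum>j<n. (B (b i) (b j))\<^sup>2)"
proof (rule antisym)
  show "(HS_norm A L x B)\<^sup>2 \<le> ereal (\<Sum>i<n. \<Sum>j<n. (B (b i) (b j))\<^sup>2)"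
  proof (rule HS_norm_sq_le)
    fix r c assume c: "orthonormal_at A L x {..<r} c"
    have r: "r \<le> n" using orthonormal_le_dim[OF c] dim by simp
    obtain c' where c': "orthonormal_at A L x {..<n} c'" "\<forall>i<r. c' i = c i"
      using orthonormal_extend_to[OF c _ r] dim by auto
    have "(\<Sum>i<r. \<Sum>j<r. (B (c i) (c j))\<^sup>2) = (\<Sum>i<r. \<Sum>j<r. (B (c' i) (c' j))\<^sup>2)"
      by (intro sum.cong refl) (simp add: c'(2))
    also have "\<dots> \<le> (\<Sum>i<n. \<Sum>j<n. (B (c' i) (c' j))\<^sup>2)"
      by (rule double_sum_square_le[OF r])
    also have "\<dots> = (\<Sum>i<n. \<Sum>j<n. (B (b i) (b j))\<^sup>2)"
      by (rule HS_basis_independent[OF b c'(1) dim B])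
    finally show "(\<Sum>i<r. \<Sum>j<r. (B (c i) (c j))\<^sup>2) \<le> (\<Sum>i<n. \<Sum>j<n. (B (b i) (b j))\<^sup>2)" .
  qed
qed (rule le_HS_norm_sq[OF b])

lemma trace_at_basis:
  assumes b: "orthonormal_at A L x {..<n} b" and dim: "dim_at A L x = enat n" and B: "quotient_form A L x B"
  shows "trace_at A L x B = (\<Sum>i<n. B (b i) (b i))"
proof -
  have "orthonormal_at A L x {..<n} (SOME b. orthonormal_at A L x {..<n} b)"
    by (rule someI[of "\<lambda>b. orthonormal_at A L x {..<n} b", OF b])
  from trace_basis_independent[OF b this dim B] show ?thesis
    by (simp add: trace_at_def dim Let_def)
qed

text \<open>
  The competitors \<open>a = - h + s \<cdot> 1\<close>: completing the square makes the first summand optimal, and a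
  multiple of the identity has the largest trace for its norm.
\<close>
lemma N_Ricci_le_shifted:
  fixes s :: real
  assumes b: "orthonormal_at A L x {..<r} b" and f: "f \<in> A"
  defines "h \<equiv> \<lambda>i j. Hess L f (b i) (b j) x"
  shows "N_Ricci A L N f x \<le> ereal (Gam2 L f f x - (\<Sum>i<r. \<Sum>j<r. (h i j)\<^sup>2) +
    (r * s\<^sup>2 - recip N * (L f x - (\<Sum>i<r. h i i) + r * s)\<^sup>2))"
proof -
  define a where "a i j = - h i j + (if i = j then s else 0)" for i j
  have sym: "a i j = a j i" for i j by (simp add: a_def h_def Hess_commute[of f "b i"])
  have le: "N_Ricci A L N f x \<le> ereal (Gam2 L f f x + (\<Sum>i<r. \<Sum>j<r. 2 * a i j * h i j + (a i j)\<^sup>2)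
      - recip N * (L f x + (\<Sum>i<r. a i i))\<^sup>2)"
    unfolding h_def by (rule N_Ricci_le[OF b f sym])
  have "(\<Sum>i<r. \<Sum>j<r. (a i j + h i j)\<^sup>2) = (\<Sum>i<r. \<Sum>j<r. if i = j then s\<^sup>2 else 0)"
    by (intro sum.cong refl) (simp add: a_def)
  also have "\<dots> = (\<Sum>i<r. s\<^sup>2)" by (intro sum.cong refl) simp
  finally have sq: "(\<Sum>i<r. \<Sum>j<r. (a i j + h i j)\<^sup>2) = r * s\<^sup>2" by simp
  have tr: "(\<Sum>i<r. a i i) = - (\<Sum>i<r. h i i) + r * s"
    by (simp add: a_def sum.distrib sum_subtractf)
  show ?thesis using le unfolding complete_square_sum sq tr by (simp add: algebra_simps)
qed

lemma N_Ricci_minus_infinity: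
  assumes b: "orthonormal_at A L x {..<r} b" and f: "f \<in> A" and N: "recip N \<ge> 0"
    and crit: "recip N * r > 1 \<or> recip N * r = 1 \<and> L f x \<noteq> (\<Sum>i<r. Hess L f (b i) (b i) x)"
  shows "N_Ricci A L N f x = - \<infinity>"
proof (rule ereal_bot)
  fix B :: real
  define c where "c = L f x - (\<Sum>i<r. Hess L f (b i) (b i) x)"
  define K where "K = Gam2 L f f x - (\<Sum>i<r. \<Sum>j<r. (Hess L f (b i) (b j) x)\<^sup>2)"
  obtain s :: real where "r * s\<^sup>2 - recip N * (c + r * s)\<^sup>2 < B - K"
    using unbounded_below_quadratic[of "recip N" "real r" c "B - K"] crit N by (auto simp: c_def)
  then show "N_Ricci A L N f x \<le> ereal B"
    using N_Ricci_le_shifted[OF b f, of N s, folded c_def K_def] by (auto elim: order_trans)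
qed

text \<open>
  The regular system need not be a basis. A matrix in the regular system is padded with zeros to one in
  a basis that extends this system, so that a bound in all bases suffices.
\<close>
lemma N_Ricci_ge_basis:
  assumes reg: "regular_orthonormal_system A L x I e" and f: "f \<in> A" and dim: "dim_at A L x = enat n"
    and bound: "\<And>b a. orthonormal_at A L x {..<n} b \<Longrightarrow>
      B \<le> Gam2 L f f x + (\<Sum>i<n. \<Sum>j<n. 2 * a i j * Hess L f (b i) (b j) x + (a i j)\<^sup>2)
        - recip N * (L f x + (\<Sum>i<n. a i i))\<^sup>2"
  shows "ereal B \<le> N_Ricci A L N f x"
proof (rule N_Ricci_ge[OF reg f])
  fix m and a :: "nat \<Rightarrow> nat \<Rightarrow> real"
  assume mI: "{..<m} \<subseteq> I"
  have "orthonormal_at A L x {..<m} e"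
    by (rule orthonormal_at_subset[OF _ mI]) (use reg in \<open>simp add: regular_orthonormal_system_def\<close>)
  moreover from orthonormal_le_dim[OF this] have m: "m \<le> n" by (simp add: dim)
  ultimately obtain b where b: "orthonormal_at A L x {..<n} b" "\<forall>i<m. b i = e i"
    using orthonormal_extend_to[of x m e n] dim by auto
  define a' where "a' i j = (if i < m \<and> j < m then a i j else 0)" for i j
  define h where "h i j = Hess L f (b i) (b j) x" for i j
  have "(\<Sum>i<n. \<Sum>j<n. 2 * a' i j * h i j + (a' i j)\<^sup>2) = (\<Sum>i<m. \<Sum>j<n. 2 * a' i j * h i j + (a' i j)\<^sup>2)"
    by (rule sum.mono_neutral_right) (use m in \<open>auto simp: a'_def\<close>)
  also have "\<dots> = (\<Sum>i<m. \<Sum>j<m. 2 * a' i j * h i j + (a' i j)\<^sup>2)"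
    by (intro sum.cong refl sum.mono_neutral_right) (use m in \<open>auto simp: a'_def\<close>)
  also have "\<dots> = (\<Sum>i<m. \<Sum>j<m. 2 * a i j * Hess L f (e i) (e j) x + (a i j)\<^sup>2)"
    by (intro sum.cong refl) (use b(2) in \<open>auto simp: a'_def h_def\<close>)
  finally have q: "(\<Sum>i<n. \<Sum>j<n. 2 * a' i j * h i j + (a' i j)\<^sup>2) =
    (\<Sum>i<m. \<Sum>j<m. 2 * a i j * Hess L f (e i) (e j) x + (a i j)\<^sup>2)" .
  have "(\<Sum>i<n. a' i i) = (\<Sum>i<m. a' i i)"
    by (rule sum.mono_neutral_right) (use m in \<open>auto simp: a'_def\<close>)
  also have "\<dots> = (\<Sum>i<m. a i i)" by (intro sum.cong refl) (simp add: a'_def)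
  finally have t: "(\<Sum>i<n. a' i i) = (\<Sum>i<m. a i i)" .
  show "B \<le> Gam2 L f f x + (\<Sum>i<m. \<Sum>j<m. 2 * a i j * Hess L f (e i) (e j) x + (a i j)\<^sup>2)
        - recip N * (L f x + (\<Sum>i<m. a i i))\<^sup>2"
    using bound[OF b(1), of a'] q t by (simp add: h_def)
qed (simp add: dim)

text \<open>
  The value of the infimum, expressed in one orthonormal basis. By invariance the lower bound,
  which refers to bases extending the regular system, can be compared with it.
\<close>
lemma N_Ricci_finite_dim:
  assumes reg: "regular_orthonormal_system A L x I e" and f: "f \<in> A" and dim: "dim_at A L x = enat n"
    and b: "orthonormal_at A L x {..<n} b" and N: "1 \<le> N" "ereal (real n) \<le> N"
  defines "S \<equiv> \<Sum>i<n. \<Sum>j<n. (Hess L f (b i) (b j) x)\<^sup>2" and "T \<equiv> \<Sum>i<n. Hess L f (b i) (b i) x"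
  shows "ereal (real n) < N \<Longrightarrow>
      N_Ricci A L N f x = ereal (Gam2 L f f x - S - recip (N - ereal (real n)) * (L f x - T)\<^sup>2)" (is
          "?sup \<Longrightarrow> ?A")
    and "N = ereal (real n) \<Longrightarrow> L f x = T \<Longrightarrow> N_Ricci A L N f x = ereal (Gam2 L f f x - S)"
    and "N = ereal (real n) \<Longrightarrow> L f x \<noteq> T \<Longrightarrow> N_Ricci A L N f x = - \<infinity>"
proof -
  have H: "quotient_form A L x (\<lambda>g h. Hess L f g h x)" by (rule quotient_form_Hess[OF reg f dim])
  have inv: "(\<Sum>i<n. \<Sum>j<n. (Hess L f (b' i) (b' j) x)\<^sup>2) = S" "(\<Sum>i<n. Hess L f (b' i) (b' i) x) = T"
    if "orthonormal_at A L x {..<n} b'" for b'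
    using HS_basis_independent[OF b that dim H] trace_basis_independent[OF b that dim H]
    by (simp_all add: S_def T_def)
  have le: "N_Ricci A L N f x \<le> ereal (Gam2 L f f x - S + (n * s\<^sup>2 - recip N * (L f x - T + n * s)\<^sup>2))"
      for s :: real
    unfolding S_def T_def by (rule N_Ricci_le_shifted[OF b f])
  show ?A if ?sup
  proof (rule antisym)
    define k where "k = recip N"
    define c where "c = L f x - T"
    define d where "d = 1 - k * n"
    note r = recip_diff[OF N(1) that]
    have d: "d > 0" and rk: "recip (N - ereal (real n)) = k / d" and kn: "k * n = 1 - d"
      using r by (auto simp: k_def d_def)
    \<comment> \<open>The critical point of \<open>n s\<^sup>2 - k (c + n s)\<^sup>2\<close>.\<close>
    define s where "s = k * c / d"
    have "c + n * s = c * (d + k * n) / d" using d by (simp add: s_def field_simps)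
    then have cs: "c + n * s = c / d" using kn by simp
    have "n * s\<^sup>2 - k * (c + n * s)\<^sup>2 = k * c\<^sup>2 * (k * n) / d\<^sup>2 - k * c\<^sup>2 / d\<^sup>2"
      unfolding cs by (simp add: s_def power2_eq_square)
    also have "\<dots> = - (k / d * c\<^sup>2)"
      unfolding kn using d by (simp add: field_simps power2_eq_square)
    finally show "N_Ricci A L N f x \<le> ereal (Gam2 L f f x - S - recip (N - ereal (real n)) * (L f x - T)\<^sup>2)"
      using le[of s] by (simp add: rk k_def[symmetric] c_def[symmetric])
    show "ereal (Gam2 L f f x - S - recip (N - ereal (real n)) * (L f x - T)\<^sup>2) \<le> N_Ricci A L N f x"
    proof (rule N_Ricci_ge_basis[OF reg f dim])
      fix b' and a :: "nat \<Rightarrow> nat \<Rightarrow> real" assume b': "orthonormal_at A L x {..<n} b'"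
      show "Gam2 L f f x - S - recip (N - ereal (real n)) * (L f x - T)\<^sup>2 \<le>
          Gam2 L f f x + (\<Sum>i<n. \<Sum>j<n. 2 * a i j * Hess L f (b' i) (b' j) x + (a i j)\<^sup>2)
            - recip N * (L f x + (\<Sum>i<n. a i i))\<^sup>2"
        using quadratic_lower_subcritical[OF r(1,2), of "\<lambda>i j. Hess L f (b' i) (b' j) x" "L f x" a]
        unfolding inv[OF b'] r(3) by simp
    qed
  qed
  have rn: "recip N \<ge> 0" "recip N * n = 1" if "N = ereal (real n)"
    using N(1) that by (simp_all add: recip_ereal one_ereal_def)
  show "N_Ricci A L N f x = ereal (Gam2 L f f x - S)" if eq: "N = ereal (real n)" and T: "L f x = T"
  proof (rule antisym)
    show "N_Ricci A L N f x \<le> ereal (Gam2 L f f x - S)" using le[of 0] by (simp add: T)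
    show "ereal (Gam2 L f f x - S) \<le> N_Ricci A L N f x"
    proof (rule N_Ricci_ge_basis[OF reg f dim])
      fix b' and a :: "nat \<Rightarrow> nat \<Rightarrow> real" assume b': "orthonormal_at A L x {..<n} b'"
      show "Gam2 L f f x - S \<le>
          Gam2 L f f x + (\<Sum>i<n. \<Sum>j<n. 2 * a i j * Hess L f (b' i) (b' j) x + (a i j)\<^sup>2)
            - recip N * (L f x + (\<Sum>i<n. a i i))\<^sup>2"
        using quadratic_lower_critical[OF rn(2)[OF eq], of "L f x" "\<lambda>i j. Hess L f (b' i) (b' j) x" a]
        unfolding inv[OF b'] by (simp add: T)
    qed
  qed
  show "N_Ricci A L N f x = - \<infinity>" if eq: "N = ereal (real n)" and T: "L f x \<noteq> T"
    using N_Ricci_minus_infinity[OF b f rn(1)[OF eq]] rn(2)[OF eq] T by (simp add: T_def)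
qed

text \<open>
  Expand the square and use \<open>\<Gamma>(b\<^sub>i, b\<^sub>j) = \<delta>\<^sub>i\<^sub>j\<close>; for \<open>c = 1/N \<cdot> L f\<close> this relates the two forms of the
  dimensional identity.
\<close>
lemma HS_norm_sq_traceless:
  fixes c :: real
  assumes b: "orthonormal_at A L x {..<n} b" and dim: "dim_at A L x = enat n" and B: "quotient_form A L x B"
  shows "(HS_norm A L x (\<lambda>g h. B g h - c * Gam L g h x))\<^sup>2 =
    ereal ((\<Sum>i<n. \<Sum>j<n. (B (b i) (b j))\<^sup>2) - 2 * c * (\<Sum>i<n. B (b i) (b i)) + n * c\<^sup>2)"
proof -
  have "(\<Sum>i<n. \<Sum>j<n. (B (b i) (b j) - c * Gam L (b i) (b j) x)\<^sup>2) =
     (\<Sum>i<n. \<Sum>j<n. (B (b i) (b j))\<^sup>2 + (if i = j then c\<^sup>2 - 2 * c * B (b i) (b j) else 0))"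
    by (intro sum.cong refl)
       (use b in \<open>auto simp: orthonormal_at_def power2_eq_square algebra_simps\<close>)
  also have "\<dots> = (\<Sum>i<n. \<Sum>j<n. (B (b i) (b j))\<^sup>2) + (\<Sum>i<n. c\<^sup>2 - 2 * c * B (b i) (b i))"
  proof -
    have "(\<Sum>j<n. if i = j then c\<^sup>2 - 2 * c * B (b i) (b j) else 0) = c\<^sup>2 - 2 * c * B (b i) (b i)" if "i
        < n" for i
      using that by simp
    then show ?thesis by (simp add: sum.distrib)
  qed
  finally show ?thesis
    unfolding HS_norm_sq_basis[OF b dim quotient_form_diff[OF B quotient_form_Gam]]
    by (simp add: sum_subtractf sum_distrib_left)
qed

lemma N_Ricci_formula:
  assumes reg: "regular_orthonormal_system A L x I e" and f: "f \<in> A" and dim: "dim_at A L x = enat n"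
    and N: "1 \<le> N" "ereal (real n) \<le> N"
  defines "H \<equiv> \<lambda>g h. Hess L f g h x"
  shows "N_Ricci A L N f x = ereal (Gam2 L f f x) -
      ((HS_norm A L x H)\<^sup>2 + quot_term n (\<lambda>M. (trace_at A L x H - L f x)\<^sup>2) N)" (is ?first)
    and "N_Ricci A L N f x = ereal (Gam2 L f f x) -
      (ereal (recip N * (L f x)\<^sup>2) + (HS_norm A L x (\<lambda>g h. H g h - recip N * L f x * Gam L g h x))\<^sup>2 +
       quot_term n (\<lambda>M. (trace_at A L x H - real n * recip M * L f x)\<^sup>2) N)" (is ?second)
    and "N_Ricci A L N f x > - \<infinity> \<longleftrightarrow> N > ereal (real n) \<or> N = ereal (real n) \<and> trace_at A L x H = L f x"
        (is ?third)
proof -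
  obtain b where b: "orthonormal_at A L x {..<n} b" using exists_orthonormal[of n x] dim by auto
  define S where "S = (\<Sum>i<n. \<Sum>j<n. (H (b i) (b j))\<^sup>2)"
  define T where "T = (\<Sum>i<n. H (b i) (b i))"
  define l where "l = L f x"
  have HB: "quotient_form A L x H" unfolding H_def by (rule quotient_form_Hess[OF reg f dim])
  have HS: "(HS_norm A L x H)\<^sup>2 = ereal S" unfolding S_def by (rule HS_norm_sq_basis[OF b dim HB])
  have tr: "trace_at A L x H = T" unfolding T_def by (rule trace_at_basis[OF b dim HB])
  have HS': "(HS_norm A L x (\<lambda>g h. H g h - recip N * l * Gam L g h x))\<^sup>2 =
      ereal (S - 2 * (recip N * l) * T + n * (recip N * l)\<^sup>2)"
    unfolding S_def T_def by (rule HS_norm_sq_traceless[OF b dim HB])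
  have S: "(\<Sum>i<n. \<Sum>j<n. (Hess L f (b i) (b j) x)\<^sup>2) = S" and T: "(\<Sum>i<n. Hess L f (b i) (b i) x) = T"
    by (simp_all add: S_def T_def H_def)
  note ric = N_Ricci_finite_dim[OF reg f dim b N, unfolded S T, folded l_def]
  have "?first \<and> ?second \<and> ?third"
  proof (cases "ereal (real n) < N")
    case True
    define k where "k = recip N"
    define d where "d = 1 - k * n"
    note r = recip_diff[OF N(1) True]
    have d: "d > 0" and rk: "recip (N - ereal (real n)) = k / d" and kn: "k * n = 1 - d"
      using r by (auto simp: k_def d_def)
    \<comment> \<open>The two right-hand sides of the dimensional identity agree as rational functions of \<open>k = 1/N\<close>.\<close>
    have "S - 2 * (k * l) * T + n * (k * l)\<^sup>2 + k * l\<^sup>2 + k / d * (T - n * k * l)\<^sup>2 - S - k / d * (l - T)\<^sup>2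
       = k * l * (- 2 * T + (k * n) * l + l) + k / d * ((T - (k * n) * l)\<^sup>2 - (l - T)\<^sup>2)"
      by (simp add: power2_eq_square algebra_simps)
    also have "\<dots> = k * l * (2 * l - 2 * T - d * l) + k / d * (d * (2 * (T - l) * l + d * l\<^sup>2))"
      unfolding kn by (simp add: power2_eq_square algebra_simps)
    also have "\<dots> = 0" using d by (simp add: power2_eq_square algebra_simps)
    finally have eq: "k * l\<^sup>2 + (S - 2 * (k * l) * T + n * (k * l)\<^sup>2) + k / d * (T - n * k * l)\<^sup>2
        = S + k / d * (T - l)\<^sup>2" by (simp add: power2_commute)
    show ?thesis
      unfolding HS tr l_def[symmetric] HS' quot_term_supercritical[OF True] ric(1)[OF True] rk
      unfolding k_def[symmetric] using True eq by (simp add: power2_commute)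
  next
    case False
    then have NN: "N = ereal (real n)" using N(2) by simp
    have n: "real n \<ge> 1" using N(1) NN by (simp add: one_ereal_def)
    have rN: "recip N = 1 / n" using n NN by (simp add: recip_ereal)
    have rM: "\<forall>\<^sub>F M in at_right (real n). recip (ereal M) = 1 / M"
      using eventually_at_right_less[of "real n"] by eventually_elim (use n in \<open>simp add: recip_ereal\<close>)
    show ?thesis
    proof (cases "l = T")
      case True
      have q1: "quot_term n (\<lambda>M. (T - l)\<^sup>2) N = 0"
        unfolding NN by (rule quot_term_critical) (simp add: True zero_ereal_def)
      \<comment> \<open>Here \<open>T - n l / M = l (M - n) / M\<close>, so the square vanishes to second order at \<open>M = n\<close>.\<close>
      have q2: "quot_term n (\<lambda>M. (T - real n * recip M * l)\<^sup>2) N = 0"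
        unfolding NN
      proof (rule quot_term_critical)
        have "((\<lambda>M. (M - real n) * l\<^sup>2 / M\<^sup>2) \<longlongrightarrow> (real n - real n) * l\<^sup>2 / (real n)\<^sup>2) (at_right (real n))"
          using n by (intro tendsto_intros) auto
        moreover have "\<forall>\<^sub>F M in at_right (real n). (M - real n) * l\<^sup>2 / M\<^sup>2 =
            (T - real n * recip (ereal M) * l)\<^sup>2 / (M - real n)"
          using eventually_at_right_less[of "real n"] rM
        proof eventually_elim
          case (elim M)
          have "T - real n * recip (ereal M) * l = l * (M - real n) / M"
            using elim n True by (simp add: field_simps)
          then show ?case using elim n by (simp add: power2_eq_square)
        qed
        ultimately have "((\<lambda>M. (T - real n * recip (ereal M) * l)\<^sup>2 / (M - real n)) \<longlongrightarrow> 0) (at_right (real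
            n))"
          using Lim_transform_eventually by fastforce
        then show "((\<lambda>M. ereal ((T - real n * recip (ereal M) * l)\<^sup>2 / (M - real n))) \<longlongrightarrow> 0) (at_right
            (real n))"
          by (simp add: zero_ereal_def)
      qed
      have "1 / n * l\<^sup>2 + (S - 2 * (1 / n * l) * T + n * (1 / n * l)\<^sup>2) = S"
        using n True by (simp add: power2_eq_square field_simps)
      then show ?thesis
        unfolding HS tr l_def[symmetric] HS' q1 q2 ric(2)[OF NN True]
        unfolding rN using True NN by simp
    next
      case False
      have q1: "quot_term n (\<lambda>M. (T - l)\<^sup>2) N = \<infinity>"
        unfolding NN by (rule quot_term_critical_infinite[OF tendsto_const]) (use False in simp)
      have q2: "quot_term n (\<lambda>M. (T - real n * recip M * l)\<^sup>2) N = \<infinity>"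
        unfolding NN
      proof (rule quot_term_critical_infinite)
        have "((\<lambda>M. (T - real n * (1 / M) * l)\<^sup>2) \<longlongrightarrow> (T - real n * (1 / real n) * l)\<^sup>2) (at_right (real n))"
          using n by (intro tendsto_intros) auto
        moreover have "\<forall>\<^sub>F M in at_right (real n). (T - real n * (1 / M) * l)\<^sup>2 = (T - real n * recip
            (ereal M) * l)\<^sup>2"
          using rM by eventually_elim simp
        ultimately have "((\<lambda>M. (T - real n * recip (ereal M) * l)\<^sup>2) \<longlongrightarrow> (T - real n * (1 / real n) * l)\<^sup>2)
            (at_right (real n))" by (rule Lim_transform_eventually)
        then show "((\<lambda>M. (T - real n * recip (ereal M) * l)\<^sup>2) \<longlongrightarrow> (T - l)\<^sup>2) (at_right (real n))"
          using n by simp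
      qed (use False in simp)
      show ?thesis
        unfolding HS tr l_def[symmetric] HS' q1 q2 ric(3)[OF NN False] using False NN by simp
    qed
  qed
  then show ?first ?second ?third by blast+
qed

text \<open>
  For \<open>N\<close> below the dimension there is an orthonormal system with more than \<open>N\<close> elements, and large
  multiples of the identity in it drive the functional to \<open>- \<infinity>\<close>. This also covers infinite dimension.
\<close>
lemma N_Ricci_below_dim:
  assumes f: "f \<in> A" and N: "1 \<le> N" "N < ereal_of_enat (dim_at A L x)"
  shows "N_Ricci A L N f x = - \<infinity>"
proof -
  obtain \<nu> where \<nu>: "N = ereal \<nu>" "\<nu> \<ge> 1" using N by (cases N) (auto simp: one_ereal_def)
  have "\<exists>r. enat r \<le> dim_at A L x \<and> \<nu> < real r"
  proof (cases "dim_at A L x")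
    case (enat n)
    then show ?thesis using N \<nu> by (intro exI[of _ n]) simp
  next
    case infinity
    then show ?thesis using reals_Archimedean2[of \<nu>] by simp
  qed
  then obtain r b where "\<nu> < real r" "orthonormal_at A L x {..<r} b" using exists_orthonormal by blast
  then show ?thesis
    using N_Ricci_minus_infinity[of x r b f N] f \<nu> by (simp add: recip_ereal field_simps)
qed

end

text \<open>
  It remains to distribute the cases. In the last part, \<open>N < n(x)\<close> is the case of the previous lemma,
  and \<open>N \<ge> n(x)\<close> forces the dimension to be finite because \<open>N = n(x) = \<infinity>\<close> is excluded.
\<close>
theorem theorem5p1:
  fixes A :: "('a \<Rightarrow> real) set" and L :: "('a \<Rightarrow> real) \<Rightarrow> 'a \<Rightarrow> real"
    and x :: 'a and I :: "nat set" and e :: "nat \<Rightarrow> 'a \<Rightarrow> real"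
  assumes "diffusion_operator A L"
    and "regular_orthonormal_system A L x I e"
  shows
    "(\<forall>f\<in>A. Ricci A L f x = ereal (Gam2 L f f x) - (HS_norm A L x (\<lambda>g h. Hess L f g h x))\<^sup>2) \<and>
     (\<forall>n::nat. dim_at A L x = enat n \<longrightarrow>
        (\<forall>N::ereal. 1 \<le> N \<longrightarrow> ereal (real n) \<le> N \<longrightarrow> (\<forall>f\<in>A.
           N_Ricci A L N f x =
             ereal (Gam2 L f f x) -
             ((HS_norm A L x (\<lambda>g h. Hess L f g h x))\<^sup>2 +
              quot_term n (\<lambda>M. (trace_at A L x (\<lambda>g h. Hess L f g h x) - L f x)\<^sup>2) N) \<and>
           N_Ricci A L N f x =
             ereal (Gam2 L f f x) -
             (ereal (recip N * (L f x)\<^sup>2) +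
              (HS_norm A L x (\<lambda>g h. Hess L f g h x - recip N * L f x * Gam L g h x))\<^sup>2 +
              quot_term n
                (\<lambda>M. (trace_at A L x (\<lambda>g h. Hess L f g h x) - real n * recip M * L f x)\<^sup>2) N)))) \<and>
     (\<forall>N::ereal. 1 \<le> N \<longrightarrow> \<not> (N = \<infinity> \<and> dim_at A L x = \<infinity>) \<longrightarrow> (\<forall>f\<in>A.
        N_Ricci A L N f x > - \<infinity> \<longleftrightarrow>
          N > ereal_of_enat (dim_at A L x) \<or>
          N = ereal_of_enat (dim_at A L x) \<and> trace_at A L x (\<lambda>g h. Hess L f g h x) = L f x))"
proof -
  interpret diffusion_operator A L by (rule assms(1))
  note reg = assms(2)
  have "N_Ricci A L N f x > - \<infinity> \<longleftrightarrow>
          N > ereal_of_enat (dim_at A L x) \<or>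
          N = ereal_of_enat (dim_at A L x) \<and> trace_at A L x (\<lambda>g h. Hess L f g h x) = L f x"
    if N: "1 \<le> N" "\<not> (N = \<infinity> \<and> dim_at A L x = \<infinity>)" and f: "f \<in> A" for N f
  proof (cases "N < ereal_of_enat (dim_at A L x)")
    case True
    then show ?thesis using N_Ricci_below_dim[OF f N(1)] by auto
  next
    case False
    then obtain n where dim: "dim_at A L x = enat n"
      using N(2) by (cases "dim_at A L x") auto
    then have "ereal (real n) \<le> N" using False by (simp add: not_less)
    from N_Ricci_formula(3)[OF reg f dim N(1) this] show ?thesis by (simp add: dim)
  qed
  then show ?thesis
    using Ricci_eq[OF reg] N_Ricci_formula(1,2)[OF reg] by blast
qed

end
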